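(* Let $c$ satisfy the Lipschitz cost assumption and let $\mu,\nu$ satisfy the ball-mass assumption (see context; $\mu\neq\nu$ is allowed). Let $N\in\mathbb{N}$, $\varepsilon>0$ sufficiently small, and set $\tau_\mu=N\exp(-\frac N2(C_\mu\varepsilon^{\mathcal{D}_\mu})^2)$, $\tau_\nu=N\exp(-\frac N2(C_\nu\varepsilon^{\mathcal{D}_\nu})^2)$. Let $v\in L^2(\nu_N)$, $u\in L^2(\mu_N)$ be a pair of left- and right-singular functions of $T^\varepsilon_N$ for a singular value $\lambda>0$, i.e. $v=\frac1\lambda T^\varepsilon_Nu$ and $u=\frac1\lambda(T^\varepsilon_N)^*v$. Define $\widetilde v,\widetilde u\in C(\mathcal{X})$ by $$\widetilde v(y)=\frac1\lambda\langle t^\varepsilon_N(\cdot,y),u\rangle_{L^2(\mu_N)},\qquad\widetilde u(x)=\frac1\lambda\langle t^\varepsilon_N(x,\cdot),v\rangle_{L^2(\nu_N)}.$$ Then, with probability at least $1-\tau_\nu$, $$\|\widetilde v-(T^\nu_N)^*v\|_{L^2(\nu)}\le M\,\frac1\lambda\|u\|_{L^2(\mu_N)}\frac{W_2(\nu_N,\nu)}{\varepsilon^{1+\mathcal{D}_\nu}},$$ and, with probability at least $1-\tau_\mu$, $$\|\widetilde u-(T^\mu_N)^*u\|_{L^2(\mu)}\le M\,\frac1\lambda\|v\|_{L^2(\nu_N)}\frac{W_2(\mu_N,\mu)}{\varepsilon^{1+\mathcal{D}_\mu}},$$ where $M>0$ is a constant that does not depend on $N,\varepsilon,\lambda,u,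v$.
   Context: $(\mathcal{X},d)$ is a compact metric space, $\mathcal{P}(\mathcal{X})$ the set of Borel probability measures, $\mathrm{spt}$ denotes support, $B(x,r)=\{x':d(x,x')<r\}$, $W_2$ is the 2-Wasserstein distance for $d$. Lipschitz cost assumption: $c:\mathcal{X}\times\mathcal{X}\to\mathbb{R}$ is continuous and symmetric, $c\ge0$, $c(x,x)=0$, and there is $\mathrm{Lip}(c)>0$ with $|c(x,y)-c(x',y)|\le\mathrm{Lip}(c)\,d(x,x')$ for all $x,x',y$. Ball-mass assumption: there are constants $C_\mu,\mathcal{D}_\mu,\delta_\mu>0$ with $\mu(B(x,\delta))\ge C_\mu\delta^{\mathcal{D}_\mu}$ for all $\delta\in(0,\delta_\mu]$, $x\in\mathrm{spt}(\mu)$; moreover $C_\mu\le1$ (and $\mathcal{D}_\mu$ is at most the dimension of the ambient space when $\mathcal{X}$ is a subset of a Euclidean space). Analogous constants $C_\nu,\mathcal{D}_\nu,\delta_\nu$ exist for $\nu$. Entropic transport kernel: for $\rho,\sigma\in\mathcal{P}(\mathcal{X})$ and $\varepsilon>0$, $k^\varepsilon_{\rho\sigma}(x,y)=\exp([\alpha(x)+\beta(y)-c(x,y)]/\varepsilon)$ on $\mathcal{X}\times\mathcal{X}$, where $\alpha,\beta\in C(\mathcal{X})$ maximize $\int\alpha\,d\rho+\int\beta\,d\sigma-\varepsilon\int[\exp((\alpha(x)+\beta(y)-c(x,y))/\varepsilon)-1]\,d(\rho\otimes\sigma)(x,y)$ and satisfy, for all $x,y\in\mathcal{X}$, $\alpha(x)=-\varepsilon\log\int\exp([\beta(y')-c(x,y')]/\varepsilon)\,d\sigma(y')$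 and $\beta(y)=-\varepsilon\log\int\exp([\alpha(x')-c(x',y)]/\varepsilon)\,d\rho(x')$. Such pairs exist and $\alpha(x)+\beta(y)$ does not depend on the choice, so $k^\varepsilon_{\rho\sigma}\in C(\mathcal{X}\times\mathcal{X})$ is well defined. Data: $\mu,\nu\in\mathcal{P}(\mathcal{X})$, $\pi$ is a probability measure on $\mathcal{X}\times\mathcal{X}$ with first marginal $\mu$ and second marginal $\nu$; $(x_i,y_i)_{i=1}^N$ are i.i.d. with law $\pi$; $\pi_N=\frac1N\sum_i\delta_{(x_i,y_i)}$, with first and second marginals $\mu_N,\nu_N$. Set $t^\varepsilon_N(x,y)=\int k^\varepsilon_{\mu_N\mu_N}(x,x')\,k^\varepsilon_{\nu_N\nu_N}(y',y)\,d\pi_N(x',y')$ (continuous on $\mathcal{X}\times\mathcal{X}$) and $T^\varepsilon_N:L^2(\mu_N)\to L^2(\nu_N)$, $u\mapsto\int u(x)t^\varepsilon_N(x,\cdot)\,d\mu_N(x)$. Let $\gamma^\mu_N$ (resp. $\gamma^\nu_N$) be an unregularized optimal transport plan for cost $d^2$ from $\mu$ to $\mu_N$ (resp. from $\nu$ to $\nu_N$); $T^\mu_N:L^2(\mu)\to L^2(\mu_N)$ is characterized by $\int(T^\mu_Nf)g\,d\mu_N=\int f(x)g(x')\,d\gamma^\mu_N(x,x')$, similarly $T^\nu_N:L^2(\nu)\to L^2(\nu_N)$ with $\gamma^\nu_N$; $^*$ denotes the adjoint. *)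

theory Defs
  imports "HOL-Probability.Probability"
begin

text \<open>
  The compact metric space is a type with compact \<^term>\<open>UNIV\<close>. The class
  \<^class>\<open>second_countable_topology\<close>, which every compact metric space satisfies, makes the
  Borel sigma-algebra of the product coincide with the product of the Borel sigma-algebras.
\<close>

subsection \<open>Measures, cost and ball mass\<close>

definition borel_prob :: "'a::topological_space measure \<Rightarrow> bool" where
  "borel_prob \<mu> \<longleftrightarrow> prob_space \<mu> \<and> sets \<mu> = sets borel"

definition spt :: "'a::topological_space measure \<Rightarrow> 'a set" where
  "spt \<mu> = {x. \<forall>U. open U \<longrightarrow> x \<in> U \<longrightarrow> emeasure \<mu> U > 0}"

definition lipschitz_cost :: "('a::metric_space \<Rightarrow> 'a \<Rightarrow> real) \<Rightarrow> bool" where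
  "lipschitz_cost c \<longleftrightarrow>
     continuous_on UNIV (\<lambda>(x, y). c x y) \<and>
     (\<forall>x y. c x y = c y x) \<and> (\<forall>x y. c x y \<ge> 0) \<and> (\<forall>x. c x x = 0) \<and>
     (\<exists>L>0. \<forall>x x' y. \<bar>c x y - c x' y\<bar> \<le> L * dist x x')"

definition ball_mass :: "'a::metric_space measure \<Rightarrow> real \<Rightarrow> real \<Rightarrow> real \<Rightarrow> bool" where
  "ball_mass \<mu> C D \<delta>\<^sub>0 \<longleftrightarrow>
     0 < C \<and> C \<le> 1 \<and> 0 < D \<and> 0 < \<delta>\<^sub>0 \<and>
     (\<forall>x\<in>spt \<mu>. \<forall>\<delta>. 0 < \<delta> \<and> \<delta> \<le> \<delta>\<^sub>0 \<longrightarrow> measure \<mu> (ball x \<delta>) \<ge> C * \<delta> powr D)"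

subsection \<open>Optimal transport\<close>

definition couplings ::
  "'a::topological_space measure \<Rightarrow> 'b::topological_space measure \<Rightarrow> ('a \<times> 'b) measure set" where
  "couplings \<mu> \<nu> = {\<gamma>. borel_prob \<gamma> \<and> distr \<gamma> borel fst = \<mu> \<and> distr \<gamma> borel snd = \<nu>}"

definition sq_cost :: "('a::metric_space \<times> 'a) measure \<Rightarrow> real" where
  "sq_cost \<gamma> = (\<integral>p. (dist (fst p) (snd p))\<^sup>2 \<partial>\<gamma>)"

definition W2 :: "'a::metric_space measure \<Rightarrow> 'a measure \<Rightarrow> real" where
  "W2 \<mu> \<nu> = sqrt (INF \<gamma>\<in>couplings \<mu> \<nu>. sq_cost \<gamma>)"

definition optimal_plan :: "'a::metric_space measure \<Rightarrow> 'a measure \<Rightarrow> ('a \<times> 'a) measure \<Rightarrow> bool" where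
  "optimal_plan \<mu> \<nu> \<gamma> \<longleftrightarrow> \<gamma> \<in> couplings \<mu> \<nu> \<and> (\<forall>\<gamma>'\<in>couplings \<mu> \<nu>. sq_cost \<gamma> \<le> sq_cost \<gamma>')"

subsection \<open>Entropic transport kernel\<close>

definition entropic_dual ::
  "('a::topological_space \<Rightarrow> 'a \<Rightarrow> real) \<Rightarrow> real \<Rightarrow> 'a measure \<Rightarrow> 'a measure \<Rightarrow>
   ('a \<Rightarrow> real) \<Rightarrow> ('a \<Rightarrow> real) \<Rightarrow> real" where
  "entropic_dual c \<epsilon> \<rho> \<sigma> \<alpha> \<beta> =
     (\<integral>x. \<alpha> x \<partial>\<rho>) + (\<integral>y. \<beta> y \<partial>\<sigma>)
     - \<epsilon> * (\<integral>(x, y). exp ((\<alpha> x + \<beta> y - c x y) / \<epsilon>) - 1 \<partial>(\<rho> \<Otimes>\<^sub>M \<sigma>))"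

definition entropic_potentials ::
  "('a::topological_space \<Rightarrow> 'a \<Rightarrow> real) \<Rightarrow> real \<Rightarrow> 'a measure \<Rightarrow> 'a measure \<Rightarrow>
   ('a \<Rightarrow> real) \<Rightarrow> ('a \<Rightarrow> real) \<Rightarrow> bool" where
  "entropic_potentials c \<epsilon> \<rho> \<sigma> \<alpha> \<beta> \<longleftrightarrow>
     continuous_on UNIV \<alpha> \<and> continuous_on UNIV \<beta> \<and>
     (\<forall>\<alpha>' \<beta>'. continuous_on UNIV \<alpha>' \<longrightarrow> continuous_on UNIV \<beta>' \<longrightarrow>
        entropic_dual c \<epsilon> \<rho> \<sigma> \<alpha>' \<beta>' \<le> entropic_dual c \<epsilon> \<rho> \<sigma> \<alpha> \<beta>) \<and>
     (\<forall>x. \<alpha> x = - \<epsilon> * ln (\<integral>y'. exp ((\<beta> y' - c x y') / \<epsilon>) \<partial>\<sigma>)) \<and>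
     (\<forall>y. \<beta> y = - \<epsilon> * ln (\<integral>x'. exp ((\<alpha> x' - c x' y) / \<epsilon>) \<partial>\<rho>))"

text \<open>Potentials exist and \<open>\<alpha> x + \<beta> y\<close> is the same for all of them, so the choice is immaterial.\<close>

definition entropic_kernel ::
  "('a::topological_space \<Rightarrow> 'a \<Rightarrow> real) \<Rightarrow> real \<Rightarrow> 'a measure \<Rightarrow> 'a measure \<Rightarrow> 'a \<Rightarrow> 'a \<Rightarrow> real" where
  "entropic_kernel c \<epsilon> \<rho> \<sigma> =
     (SOME k. \<exists>\<alpha> \<beta>. entropic_potentials c \<epsilon> \<rho> \<sigma> \<alpha> \<beta> \<and>
                   k = (\<lambda>x y. exp ((\<alpha> x + \<beta> y - c x y) / \<epsilon>)))"

definition transfer_kernel ::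
  "('a::topological_space \<Rightarrow> 'a \<Rightarrow> real) \<Rightarrow> real \<Rightarrow> ('a \<times> 'a) measure \<Rightarrow> 'a \<Rightarrow> 'a \<Rightarrow> real" where
  "transfer_kernel c \<epsilon> \<pi> x y =
     (let \<mu> = distr \<pi> borel fst; \<nu> = distr \<pi> borel snd in
      \<integral>(x', y'). entropic_kernel c \<epsilon> \<mu> \<mu> x x' * entropic_kernel c \<epsilon> \<nu> \<nu> y' y \<partial>\<pi>)"

subsection \<open>Real $L^2$ spaces and operators, on representatives\<close>

definition L2_space :: "'a measure \<Rightarrow> ('a \<Rightarrow> real) set" where
  "L2_space M = {f \<in> borel_measurable M. integrable M (\<lambda>x. (f x)\<^sup>2)}"

definition L2_norm :: "'a measure \<Rightarrow> ('a \<Rightarrow> real) \<Rightarrow> real" where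
  "L2_norm M f = sqrt (\<integral>x. (f x)\<^sup>2 \<partial>M)"

definition L2_inner :: "'a measure \<Rightarrow> ('a \<Rightarrow> real) \<Rightarrow> ('a \<Rightarrow> real) \<Rightarrow> real" where
  "L2_inner M f g = (\<integral>x. f x * g x \<partial>M)"

text \<open>
  The two operators below are determined by their defining relation up to null sets, which is all
  that is used of them; a representative is chosen for each argument.
\<close>

definition L2_adjoint ::
  "'a measure \<Rightarrow> 'b measure \<Rightarrow> (('a \<Rightarrow> real) \<Rightarrow> ('b \<Rightarrow> real)) \<Rightarrow> ('b \<Rightarrow> real) \<Rightarrow> ('a \<Rightarrow> real)" where
  "L2_adjoint M M' T =
     (SOME S. \<forall>g\<in>L2_space M'. S g \<in> L2_space M \<and>
        (\<forall>f\<in>L2_space M. L2_inner M' (T f) g = L2_inner M f (S g)))"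

definition plan_operator ::
  "'a measure \<Rightarrow> 'b measure \<Rightarrow> ('a \<times> 'b) measure \<Rightarrow> ('a \<Rightarrow> real) \<Rightarrow> ('b \<Rightarrow> real)" where
  "plan_operator \<mu> \<mu>' \<gamma> =
     (SOME T. \<forall>f\<in>L2_space \<mu>. T f \<in> L2_space \<mu>' \<and>
        (\<forall>g\<in>L2_space \<mu>'. L2_inner \<mu>' (T f) g = (\<integral>(x, x'). f x * g x' \<partial>\<gamma>)))"

definition kernel_operator :: "'a measure \<Rightarrow> ('a \<Rightarrow> 'b \<Rightarrow> real) \<Rightarrow> ('a \<Rightarrow> real) \<Rightarrow> ('b \<Rightarrow> real)" where
  "kernel_operator \<mu> t u = (\<lambda>y. \<integral>x. u x * t x y \<partial>\<mu>)"

definition singular_pair ::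
  "'a measure \<Rightarrow> 'b measure \<Rightarrow> (('a \<Rightarrow> real) \<Rightarrow> ('b \<Rightarrow> real)) \<Rightarrow> real \<Rightarrow>
   ('a \<Rightarrow> real) \<Rightarrow> ('b \<Rightarrow> real) \<Rightarrow> bool" where
  "singular_pair \<mu> \<nu> T s u v \<longleftrightarrow>
     0 < s \<and> u \<in> L2_space \<mu> \<and> v \<in> L2_space \<nu> \<and>
     (AE y in \<nu>. v y = (1 / s) * T u y) \<and>
     (AE x in \<mu>. u x = (1 / s) * L2_adjoint \<mu> \<nu> T v x)"

subsection \<open>Sampling\<close>

definition empirical :: "nat \<Rightarrow> (nat \<Rightarrow> 'a::topological_space) \<Rightarrow> 'a measure" where
  "empirical N z = distr (uniform_count_measure {..<N}) borel z"

definition iid_sample ::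
  "'w measure \<Rightarrow> nat \<Rightarrow> 'a::topological_space measure \<Rightarrow> (nat \<Rightarrow> 'w \<Rightarrow> 'a) \<Rightarrow> bool" where
  "iid_sample P N \<pi> Z \<longleftrightarrow>
     prob_space P \<and> prob_space.indep_vars P (\<lambda>_. borel) Z {..<N} \<and>
     (\<forall>i<N. distr P borel (Z i) = \<pi>)"

text \<open>
  The set of good outcomes need not be measurable, as it quantifies over all singular pairs and
  optimal plans; it is required to contain an event of the given probability.
\<close>

definition with_prob_at_least :: "'w measure \<Rightarrow> real \<Rightarrow> ('w \<Rightarrow> bool) \<Rightarrow> bool" where
  "with_prob_at_least P p Q \<longleftrightarrow> (\<exists>A\<in>sets P. measure P A \<ge> p \<and> (\<forall>\<omega>\<in>A. Q \<omega>))"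

definition sample_defect :: "nat \<Rightarrow> real \<Rightarrow> real \<Rightarrow> real \<Rightarrow> real" where
  "sample_defect N \<epsilon> C D = N * exp (- (N / 2) * (C * \<epsilon> powr D)\<^sup>2)"

end

theory Submission
  imports Defs "HOL-Real_Asymp.Real_Asymp"
begin

text \<open>
  Write \<open>w y\<close> for the extension \<open>(1 / s) * \<integral>x. t x y * u x \<partial>\<mu>\<^sub>N\<close> of the singular function \<open>v\<close>. On the
  sample the singular relation says \<open>v = w\<close>, and the adjoint of the plan operator sends \<open>v\<close> to the
  conditional mean of \<open>v y'\<close> given \<open>y\<close> under the plan \<open>\<gamma>\<close>. So the difference to be estimated is the
  conditional mean of \<open>w y - w y'\<close>, and its norm is at most the Lipschitz constant of \<open>w\<close> times the
  root mean square displacement of \<open>\<gamma>\<close>, which is the Wasserstein distance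
  (\<open>plan_adjoint_distance\<close>, \<open>optimal_plan_le_W2\<close>). Everything therefore rests on a Lipschitz bound
  for \<open>t x y\<close> in \<open>y\<close> that is uniform in \<open>x\<close>.

  The kernel \<open>t x y\<close> averages \<open>k\<^sub>\<nu> y' y\<close> over the sample with weights \<open>k\<^sub>\<mu> x x'\<close>, and the fixed point
  equations of the entropic potentials say exactly that these weights have mean one. So only
  \<open>y \<mapsto> k\<^sub>\<nu> y' y\<close> at sample points \<open>y'\<close> matters. A potential is a soft minimum of Lipschitz functions,
  hence is itself Lipschitz, and moving one argument of \<open>k\<^sub>\<nu>\<close> by \<open>d\<close> changes the kernel at most by a
  factor \<open>exp (2 * L * d / \<epsilon>)\<close>. Its mean over \<open>y'\<close> is one, so where it is large at \<open>y'\<close> it is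
  comparably large on the whole ball of radius \<open>\<epsilon>\<close> about \<open>y'\<close>; this bounds it by \<open>exp (2 * L)\<close>
  divided by the mass of that ball under \<open>\<nu>\<^sub>N\<close> (\<open>balanced_kernel_bound\<close>). If every such ball carries
  mass at least \<open>C * \<epsilon> powr D / 2\<close>, the Lipschitz constant is of order \<open>1 / \<epsilon> powr (1 + D)\<close>
  (\<open>transfer_kernel_lipschitz\<close>).

  That condition on the balls is the only random ingredient. For a fixed centre Hoeffding's
  inequality bounds the probability that it fails, the centre \<open>y\<^sub>i\<close> is independent of the other
  sample points, and a union bound over the \<open>N\<close> centres gives the stated probability
  (\<open>iid_ball_mass_event\<close>). The estimate for \<open>u\<close> is the same with the arguments of the kernels
  exchanged.

  Since the kernels, the plan operators and the adjoints are given by choice, their existence has to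
  be proved as well. On an empirical measure the entropic potentials come from a finite-dimensional
  minimization (\<open>symmetric_scaling_exists\<close>), and the conditional means come from the
  Radon-Nikodym theorem (\<open>coupling_conditional\<close>).
\<close>

section \<open>Symmetric matrix scaling\<close>

text \<open>
  The unknowns are logarithms of the factors that turn the matrix \<open>exp (- C i j)\<close> into one with
  constant row sums. The equations are the stationarity conditions of a function \<open>F\<close> whose diagonal
  terms already make it coercive, so \<open>F\<close> attains its minimum inside a large box.
\<close>

lemma symmetric_scaling_exists:
  fixes C :: "nat \<Rightarrow> nat \<Rightarrow> real"
  assumes N: "N \<ge> 1" and sym: "\<And>i j. C i j = C j i" and diag: "\<And>i. C i i = 0"
  obtains a where "\<And>i. i < N \<Longrightarrow> (\<Sum>j<N. exp (a i + a j - C i j)) = N"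
proof -
  define F :: "(nat \<Rightarrow> real) \<Rightarrow> real"
    where "F a = (\<Sum>i<N. \<Sum>j<N. exp (a i + a j - C i j)) - 2 * N * (\<Sum>i<N. a i)" for a :: "nat \<Rightarrow> real"
  \<comment> \<open>\<open>\<phi>\<close> is the diagonal plus the linear term of one coordinate, and \<open>m\<close> is its minimum, attained at
    \<open>ln N / 2\<close>.\<close>
  define \<phi> :: "real \<Rightarrow> real" where "\<phi> s = exp (2 * s) - 2 * N * s" for s :: real
  define m :: real where "m = N * (1 - ln N)"
  define B where "B = F (\<lambda>_. 0) - (N - 1) * m"
  have m: "m \<le> \<phi> s" for s
  proof -
    have "1 + (2 * s - ln N) \<le> exp (2 * s - ln N)" by (rule exp_ge_add_one_self)
    also have "\<dots> = exp (2 * s) / N" using N by (simp add: exp_diff)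
    finally show ?thesis using N by (simp add: m_def \<phi>_def field_simps)
  qed
  have F_ge: "\<phi> (a i) + (N - 1) * m \<le> F a" if "i < N" for a i
  proof -
    have "\<phi> (a i) + (N - 1) * m \<le> \<phi> (a i) + (\<Sum>j\<in>{..<N} - {i}. \<phi> (a j))"
      using that m sum_bounded_below[of "{..<N} - {i}" m "\<lambda>j. \<phi> (a j)"] N
      by (simp add: of_nat_diff)
    also have "\<dots> = (\<Sum>j<N. \<phi> (a j))" using that by (simp add: sum.remove)
    also have "\<dots> = (\<Sum>j<N. exp (a j + a j - C j j)) - 2 * N * (\<Sum>i<N. a i)"
      by (simp add: \<phi>_def sum_subtractf sum_distrib_left diag)
    also have "\<dots> \<le> F a"
      unfolding F_def by (intro diff_right_mono sum_mono member_le_sum) auto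
    finally show ?thesis .
  qed
  have "filterlim \<phi> at_top at_top" "filterlim \<phi> at_top at_bot"
    unfolding \<phi>_def using N by real_asymp+
  then have "eventually (\<lambda>s. B < \<phi> s) at_top" "eventually (\<lambda>s. B < \<phi> s) at_bot"
    by (auto simp: filterlim_at_top_dense)
  then obtain R1 R2 where R1: "\<And>s. R1 \<le> s \<Longrightarrow> B < \<phi> s" and R2: "\<And>s. s \<le> R2 \<Longrightarrow> B < \<phi> s"
    by (auto simp: eventually_at_top_linorder eventually_at_bot_linorder)
  define R where "R = max (max R1 (- R2)) 1"
  have R: "R > 0" "\<And>s. R \<le> \<bar>s\<bar> \<Longrightarrow> B < \<phi> s"
    using R1 R2 by (auto simp: R_def abs_if split: if_splits)
  \<comment> \<open>The box bounds all coordinates, also those on which \<open>F\<close> does not depend, so that it is compact in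
    the product topology.\<close>
  let ?K = "PiE UNIV (\<lambda>_::nat. {-R..R})"
  have "compact ?K"
    using compactin_PiE[of "\<lambda>_::nat. euclidean :: real topology" UNIV "\<lambda>_. {-R..R}"]
    by (auto simp: euclidean_product_topology)
  moreover have "continuous_on ?K F"
    unfolding F_def
    by (intro continuous_intros continuous_on_subset[OF continuous_on_product_coordinates]) auto
  ultimately obtain a where a: "a \<in> ?K" and min: "\<And>b. b \<in> ?K \<Longrightarrow> F a \<le> F b"
    using continuous_attains_inf[of ?K F] R(1) by (metis (no_types, lifting) PiE_eq_empty_iff atLeastAtMost_iff empty_iff less_eq_real_def neg_less_0_iff_less order.trans)
  have "F a \<le> F (\<lambda>_. 0)" using R(1) by (intro min) auto
  show thesis
  proof
    fix i assume i: "i < N"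
    have ai: "\<bar>a i\<bar> < R"
      using R(2)[of "a i"] F_ge[OF i, of a] \<open>F a \<le> _\<close> by (fastforce simp: B_def)
    \<comment> \<open>The minimizer is interior in direction \<open>i\<close>, so the derivative of \<open>F\<close> in that direction vanishes.\<close>
    define E where "E j k = exp (a j + a k - C j k)" for j k
    define \<Phi> where "\<Phi> h = F (\<lambda>j. a j + h * of_bool (j = i))" for h
    have "DERIV \<Phi> 0 :> (\<Sum>j<N. \<Sum>k<N. (of_bool (j = i) + of_bool (k = i)) * E j k) - 2 * N"
    proof -
      have "DERIV (\<lambda>h. exp (a j + h * d + (a k + h * e) - C j k)) 0 :> (d + e) * E j k" for j k d e
        unfolding E_def by (auto intro!: derivative_eq_intros)
      then have 1: "DERIV (\<lambda>h. \<Sum>j<N. \<Sum>k<N. exp (a j + h * of_bool (j = i) + (a k + h * of_bool (k = i)) - C j k)) 0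
          :> (\<Sum>j<N. \<Sum>k<N. (of_bool (j = i) + of_bool (k = i)) * E j k)"
        by (intro DERIV_sum)
      have "DERIV (\<lambda>h. \<Sum>j<N. a j + h * of_bool (j = i)) 0 :> (\<Sum>j<N. of_bool (j = i))"
        by (auto intro!: derivative_eq_intros)
      then have 2: "DERIV (\<lambda>h. \<Sum>j<N. a j + h * of_bool (j = i)) 0 :> 1" using i by simp
      show ?thesis
        unfolding \<Phi>_def F_def using DERIV_diff[OF 1 DERIV_cmult[OF 2, of "2 * N"]] by simp
    qed
    moreover have "\<Phi> 0 \<le> \<Phi> h" if "\<bar>0 - h\<bar> < R - \<bar>a i\<bar>" for h
    proof -
      have "F a \<le> F (\<lambda>j. a j + h * of_bool (j = i))"
        using that a by (intro min) (auto simp: PiE_iff abs_if split: if_splits)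
      then show ?thesis by (simp add: \<Phi>_def)
    qed
    ultimately have "(\<Sum>j<N. \<Sum>k<N. (of_bool (j = i) + of_bool (k = i)) * E j k) - 2 * N = 0"
      using ai by (intro DERIV_local_min[of \<Phi> _ 0 "R - \<bar>a i\<bar>"]) auto
    moreover have "(\<Sum>j<N. \<Sum>k<N. (of_bool (j = i) + of_bool (k = i)) * E j k)
        = (\<Sum>k<N. E i k) + (\<Sum>j<N. E j i)"
    proof -
      have "(\<Sum>j<N. \<Sum>k<N. of_bool (j = i) * E j k) = (\<Sum>j<N. of_bool (j = i) * (\<Sum>k<N. E j k))"
        by (simp add: sum_distrib_left)
      also have "\<dots> = (\<Sum>k<N. E i k)" using i by simp
      finally show ?thesis using i by (simp add: distrib_right sum.distrib)
    qed
    moreover have "(\<Sum>j<N. E j i) = (\<Sum>k<N. E i k)"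
      by (intro sum.cong) (auto simp: E_def sym[of _ i] add_ac)
    ultimately show "(\<Sum>j<N. exp (a i + a j - C i j)) = N" by (simp add: E_def)
  qed
qed

section \<open>Entropic potentials\<close>

lemma real_bounded_continuous:
  fixes f :: "'a::topological_space \<Rightarrow> real"
  assumes "compact (UNIV :: 'a set)" "continuous_on UNIV f"
  obtains B where "\<And>x. \<bar>f x\<bar> \<le> B"
  using compact_imp_bounded[OF compact_continuous_image[OF assms(2,1)]]
  by (auto simp: bounded_iff)

lemma borel_prob_integrable:
  fixes f :: "'a::topological_space \<Rightarrow> real"
  assumes "compact (UNIV :: 'a set)" "borel_prob \<rho>" "continuous_on UNIV f"
  shows "integrable \<rho> f"
proof -
  interpret prob_space \<rho> using assms by (simp add: borel_prob_def)
  obtain B where "\<And>x. \<bar>f x\<bar> \<le> B" using real_bounded_continuous assms by metis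
  moreover have "f \<in> borel_measurable \<rho>"
    using borel_measurable_continuous_onI[OF assms(3)] assms(2) measurable_cong_sets
    by (auto simp: borel_prob_def)
  ultimately show ?thesis by (intro integrable_const_bound[of _ B]) auto
qed

lemma borel_prob_pair:
  fixes \<rho> \<sigma> :: "'a::second_countable_topology measure"
  assumes "borel_prob \<rho>" "borel_prob \<sigma>"
  shows "borel_prob (\<rho> \<Otimes>\<^sub>M \<sigma>)"
proof -
  interpret pair_prob_space \<rho> \<sigma>
    using assms by (auto simp: borel_prob_def pair_prob_space_def pair_sigma_finite_def
        prob_space_imp_sigma_finite)
  show ?thesis
    using assms prob_space_axioms by (simp add: borel_prob_def borel_prod[symmetric] cong: sets_pair_measure_cong)
qed

lemma integral_pair_borel:
  fixes f :: "'a::{second_countable_topology} \<times> 'a \<Rightarrow> real"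
  assumes "compact (UNIV :: 'a set)" "borel_prob \<rho>" "borel_prob \<sigma>" "continuous_on UNIV f"
  shows "(\<integral>p. f p \<partial>(\<rho> \<Otimes>\<^sub>M \<sigma>)) = (\<integral>x. \<integral>y. f (x, y) \<partial>\<sigma> \<partial>\<rho>)"
    and "(\<integral>p. f p \<partial>(\<rho> \<Otimes>\<^sub>M \<sigma>)) = (\<integral>y. \<integral>x. f (x, y) \<partial>\<rho> \<partial>\<sigma>)"
proof -
  interpret pair_prob_space \<rho> \<sigma>
    using assms by (auto simp: borel_prob_def pair_prob_space_def pair_sigma_finite_def
        prob_space_imp_sigma_finite)
  have "compact (UNIV :: ('a \<times> 'a) set)"
    using compact_Times[OF assms(1,1)] by simp
  then have "integrable (\<rho> \<Otimes>\<^sub>M \<sigma>) f"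
    using assms borel_prob_pair by (intro borel_prob_integrable) auto
  then have "integrable (\<rho> \<Otimes>\<^sub>M \<sigma>) (\<lambda>(x, y). f (x, y))" by simp
  from integral_fst[OF this] integral_snd[OF this]
  show "(\<integral>p. f p \<partial>(\<rho> \<Otimes>\<^sub>M \<sigma>)) = (\<integral>x. \<integral>y. f (x, y) \<partial>\<sigma> \<partial>\<rho>)"
    and "(\<integral>p. f p \<partial>(\<rho> \<Otimes>\<^sub>M \<sigma>)) = (\<integral>y. \<integral>x. f (x, y) \<partial>\<rho> \<partial>\<sigma>)" by simp_all
qed

lemma gibbs_continuous:
  fixes c :: "'a::topological_space \<Rightarrow> 'a \<Rightarrow> real"
  assumes "continuous_on UNIV (\<lambda>(x, y). c x y)" "continuous_on UNIV \<alpha>" "continuous_on UNIV \<beta>"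
  shows "continuous_on UNIV (\<lambda>(x, y). exp ((\<alpha> x + \<beta> y - c x y) / \<epsilon>))"
proof -
  have "continuous_on UNIV (\<lambda>p. \<alpha> (fst p))" "continuous_on UNIV (\<lambda>p. \<beta> (snd p))"
    by (auto intro!: continuous_on_compose2[OF assms(2)] continuous_on_compose2[OF assms(3)] continuous_intros)
  moreover have "continuous_on UNIV (\<lambda>p. c (fst p) (snd p))"
    using assms(1) by (simp add: case_prod_unfold)
  ultimately show ?thesis
    unfolding case_prod_unfold by (cases "\<epsilon> = 0") (auto intro!: continuous_intros)
qed

lemma continuous_slices:
  fixes f :: "'a::topological_space \<Rightarrow> 'b::topological_space \<Rightarrow> real"
  assumes "continuous_on UNIV (\<lambda>(x, y). f x y)"
  shows "continuous_on UNIV (f x)" "continuous_on UNIV (\<lambda>x. f x y)"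
proof -
  have "continuous_on UNIV (\<lambda>y::'b. (x, y))" "continuous_on UNIV (\<lambda>x::'a. (x, y))"
    by (auto intro!: continuous_on_Pair continuous_on_const continuous_on_id)
  from this[THEN continuous_on_compose2[OF assms]]
  show "continuous_on UNIV (f x)" "continuous_on UNIV (\<lambda>x. f x y)" by auto
qed

lemma integral_exp_pos:
  fixes f :: "'a::topological_space \<Rightarrow> real"
  assumes "compact (UNIV :: 'a set)" "borel_prob \<rho>" "continuous_on UNIV f"
  shows "0 < (\<integral>x. exp (f x) \<partial>\<rho>)"
proof -
  interpret prob_space \<rho> using assms by (simp add: borel_prob_def)
  obtain B where B: "\<And>x. \<bar>f x\<bar> \<le> B" using real_bounded_continuous assms by metis
  have "exp (- B) = (\<integral>x. exp (- B) \<partial>\<rho>)" by (simp add: prob_space)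
  also have "\<dots> \<le> (\<integral>x. exp (f x) \<partial>\<rho>)"
    using assms B by (intro integral_mono borel_prob_integrable) (auto intro!: continuous_intros simp: abs_le_iff minus_le_iff)
  finally show ?thesis by (smt (verit) exp_gt_zero)
qed

text \<open>
  A fixed point equation of the potentials is the normalization of the corresponding marginal of the
  kernel.
\<close>

lemma gibbs_normalized:
  fixes f g :: "'a::topological_space \<Rightarrow> real"
  assumes X: "compact (UNIV :: 'a set)" "borel_prob \<rho>"
    and eps: "\<epsilon> > 0" and f: "continuous_on UNIV f" and g: "continuous_on UNIV g"
    and a: "a = - \<epsilon> * ln (\<integral>y. exp ((g y - f y) / \<epsilon>) \<partial>\<rho>)"
  shows "(\<integral>y. exp ((a + g y - f y) / \<epsilon>) \<partial>\<rho>) = 1"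
proof -
  have pos: "0 < (\<integral>y. exp ((g y - f y) / \<epsilon>) \<partial>\<rho>)"
    using eps f g by (intro integral_exp_pos X continuous_intros) auto
  have "(\<integral>y. exp ((a + g y - f y) / \<epsilon>) \<partial>\<rho>) = (\<integral>y. exp (a / \<epsilon>) * exp ((g y - f y) / \<epsilon>) \<partial>\<rho>)"
    by (intro Bochner_Integration.integral_cong)
      (auto simp: add_divide_distrib diff_divide_distrib exp_add exp_diff)
  also have "\<dots> = exp (a / \<epsilon>) * (\<integral>y. exp ((g y - f y) / \<epsilon>) \<partial>\<rho>)" by simp
  also have "exp (a / \<epsilon>) = 1 / (\<integral>y. exp ((g y - f y) / \<epsilon>) \<partial>\<rho>)"
    using eps pos by (simp add: a exp_minus inverse_eq_divide)
  finally show ?thesis using pos by simp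
qed

text \<open>
  The dual functional is concave, so the fixed point equations, which are its stationarity
  conditions, imply maximality. Concretely, the tangent inequality \<open>1 + s \<le> exp s\<close> bounds the
  kernel \<open>k'\<close> of a competitor from below by the linearization at \<open>k\<close>, and the mass-one marginals of
  \<open>k\<close> turn the integral of the linear part into the difference of the linear terms of the functional.
\<close>

lemma entropic_potentialsI:
  fixes c :: "'a::second_countable_topology \<Rightarrow> 'a \<Rightarrow> real"
  assumes X: "compact (UNIV :: 'a set)" and \<rho>: "borel_prob \<rho>" and \<sigma>: "borel_prob \<sigma>"
    and c: "continuous_on UNIV (\<lambda>(x, y). c x y)" and eps: "\<epsilon> > 0"
    and cont: "continuous_on UNIV \<alpha>" "continuous_on UNIV \<beta>"
    and \<alpha>: "\<And>x. \<alpha> x = - \<epsilon> * ln (\<integral>y. exp ((\<beta> y - c x y) / \<epsilon>) \<partial>\<sigma>)"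
    and \<beta>: "\<And>y. \<beta> y = - \<epsilon> * ln (\<integral>x. exp ((\<alpha> x - c x y) / \<epsilon>) \<partial>\<rho>)"
  shows "entropic_potentials c \<epsilon> \<rho> \<sigma> \<alpha> \<beta>"
proof -
  interpret \<rho>: prob_space \<rho> using \<rho> by (simp add: borel_prob_def)
  interpret \<sigma>: prob_space \<sigma> using \<sigma> by (simp add: borel_prob_def)
  interpret P: prob_space "\<rho> \<Otimes>\<^sub>M \<sigma>" using borel_prob_pair[OF \<rho> \<sigma>] by (simp add: borel_prob_def)
  have X2: "compact (UNIV :: ('a \<times> 'a) set)"
    using compact_Times[OF X X] by simp
  define k where "k p = exp ((\<alpha> (fst p) + \<beta> (snd p) - c (fst p) (snd p)) / \<epsilon>)" for p
  have k: "continuous_on UNIV k"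
    using gibbs_continuous[OF c cont] by (simp add: k_def[abs_def] case_prod_unfold)
  have int: "integrable (\<rho> \<Otimes>\<^sub>M \<sigma>) f" if "continuous_on UNIV f" for f :: "'a \<times> 'a \<Rightarrow> real"
    using that by (rule borel_prob_integrable[OF X2 borel_prob_pair[OF \<rho> \<sigma>]])
  have rows: "(\<integral>y. k (x, y) \<partial>\<sigma>) = 1" for x
    using gibbs_normalized[OF X \<sigma> eps continuous_slices(1)[OF c] cont(2) \<alpha>, of x] by (simp add: k_def)
  have cols: "(\<integral>x. k (x, y) \<partial>\<rho>) = 1" for y
    using gibbs_normalized[OF X \<rho> eps continuous_slices(2)[OF c] cont(1) \<beta>, of y]
    by (simp add: k_def add_ac)
  have fst_int: "(\<integral>p. k p * f (fst p) \<partial>(\<rho> \<Otimes>\<^sub>M \<sigma>)) = (\<integral>x. f x \<partial>\<rho>)"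
    if f: "continuous_on UNIV f" for f
  proof -
    have "continuous_on UNIV (\<lambda>p. k p * f (fst p))"
      by (intro continuous_intros k continuous_on_compose2[OF f]) auto
    from integral_pair_borel(1)[OF X \<rho> \<sigma> this] show ?thesis by (simp add: rows)
  qed
  have snd_int: "(\<integral>p. k p * f (snd p) \<partial>(\<rho> \<Otimes>\<^sub>M \<sigma>)) = (\<integral>y. f y \<partial>\<sigma>)"
    if f: "continuous_on UNIV f" for f
  proof -
    have "continuous_on UNIV (\<lambda>p. k p * f (snd p))"
      by (intro continuous_intros k continuous_on_compose2[OF f]) auto
    from integral_pair_borel(2)[OF X \<rho> \<sigma> this] show ?thesis by (simp add: cols)
  qed
  have "entropic_dual c \<epsilon> \<rho> \<sigma> \<alpha>' \<beta>' \<le> entropic_dual c \<epsilon> \<rho> \<sigma> \<alpha> \<beta>"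
    if cont': "continuous_on UNIV \<alpha>'" "continuous_on UNIV \<beta>'" for \<alpha>' \<beta>'
  proof -
    define k' where "k' p = exp ((\<alpha>' (fst p) + \<beta>' (snd p) - c (fst p) (snd p)) / \<epsilon>)" for p
    define f where "f x = (\<alpha>' x - \<alpha> x) / \<epsilon>" for x
    define g where "g y = (\<beta>' y - \<beta> y) / \<epsilon>" for y
    have fg: "continuous_on UNIV f" "continuous_on UNIV g"
      unfolding f_def g_def using eps cont cont' by (auto intro!: continuous_intros)
    have k': "continuous_on UNIV k'"
      using gibbs_continuous[OF c cont'] by (simp add: k'_def[abs_def] case_prod_unfold)
    have fg': "continuous_on UNIV (\<lambda>p. k p * f (fst p))" "continuous_on UNIV (\<lambda>p. k p * g (snd p))"
      by (auto intro!: continuous_intros k continuous_on_compose2[OF fg(1)] continuous_on_compose2[OF fg(2)])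
    have "(\<integral>p. k p \<partial>(\<rho> \<Otimes>\<^sub>M \<sigma>)) + (\<integral>x. f x \<partial>\<rho>) + (\<integral>y. g y \<partial>\<sigma>)
        = (\<integral>p. k p + k p * f (fst p) + k p * g (snd p) \<partial>(\<rho> \<Otimes>\<^sub>M \<sigma>))"
      using fst_int[OF fg(1)] snd_int[OF fg(2)] int[OF k] int[OF fg'(1)] int[OF fg'(2)] by simp
    also have "\<dots> \<le> (\<integral>p. k' p \<partial>(\<rho> \<Otimes>\<^sub>M \<sigma>))"
    proof (intro integral_mono)
      show "k p + k p * f (fst p) + k p * g (snd p) \<le> k' p" for p
      proof -
        have "k' p = k p * exp (f (fst p) + g (snd p))"
          unfolding k_def k'_def f_def g_def exp_add[symmetric]
          by (simp add: field_simps add_divide_distrib[symmetric] diff_divide_distrib[symmetric])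
        then show ?thesis
          using mult_left_mono[OF exp_ge_add_one_self[of "f (fst p) + g (snd p)"], of "k p"]
          by (simp add: k_def algebra_simps)
      qed
    qed (auto intro!: int k k' fg' continuous_intros)
    finally have "\<epsilon> * ((\<integral>p. k p \<partial>(\<rho> \<Otimes>\<^sub>M \<sigma>)) + (\<integral>x. f x \<partial>\<rho>) + (\<integral>y. g y \<partial>\<sigma>))
        \<le> \<epsilon> * (\<integral>p. k' p \<partial>(\<rho> \<Otimes>\<^sub>M \<sigma>))" using eps by simp
    moreover have "\<epsilon> * (\<integral>x. f x \<partial>\<rho>) = (\<integral>x. \<alpha>' x \<partial>\<rho>) - (\<integral>x. \<alpha> x \<partial>\<rho>)"
      using eps cont cont' borel_prob_integrable[OF X \<rho>] by (simp add: f_def)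
    moreover have "\<epsilon> * (\<integral>y. g y \<partial>\<sigma>) = (\<integral>y. \<beta>' y \<partial>\<sigma>) - (\<integral>y. \<beta> y \<partial>\<sigma>)"
      using eps cont cont' borel_prob_integrable[OF X \<sigma>] by (simp add: g_def)
    moreover have d: "(\<integral>p. k p - 1 \<partial>(\<rho> \<Otimes>\<^sub>M \<sigma>)) = (\<integral>p. k p \<partial>(\<rho> \<Otimes>\<^sub>M \<sigma>)) - 1"
      "(\<integral>p. k' p - 1 \<partial>(\<rho> \<Otimes>\<^sub>M \<sigma>)) = (\<integral>p. k' p \<partial>(\<rho> \<Otimes>\<^sub>M \<sigma>)) - 1"
      using int[OF k] int[OF k'] P.prob_space by simp_all
    ultimately have "(\<integral>x. \<alpha>' x \<partial>\<rho>) + (\<integral>y. \<beta>' y \<partial>\<sigma>) - \<epsilon> * ((\<integral>p. k' p \<partial>(\<rho> \<Otimes>\<^sub>M \<sigma>)) - 1)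
        \<le> (\<integral>x. \<alpha> x \<partial>\<rho>) + (\<integral>y. \<beta> y \<partial>\<sigma>) - \<epsilon> * ((\<integral>p. k p \<partial>(\<rho> \<Otimes>\<^sub>M \<sigma>)) - 1)"
      by (simp only: distrib_left right_diff_distrib)
    then show ?thesis
      unfolding entropic_dual_def case_prod_unfold k_def[symmetric] k'_def[symmetric] d .
  qed
  then show ?thesis
    unfolding entropic_potentials_def by (intro conjI allI impI cont \<alpha> \<beta>)
qed

section \<open>Kernels with unit marginals\<close>

text \<open>
  The properties of an entropic self-transport kernel from which the estimates follow, in a form
  that is symmetric under exchanging the two arguments.
\<close>

definition balanced_kernel ::
  "'a::metric_space measure \<Rightarrow> real \<Rightarrow> ('a \<Rightarrow> 'a \<Rightarrow> real) \<Rightarrow> bool" where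
  "balanced_kernel \<rho> \<theta> k \<longleftrightarrow>
     continuous_on UNIV (\<lambda>(x, y). k x y) \<and> (\<forall>x y. 0 < k x y) \<and>
     (\<forall>x. (\<integral>y. k x y \<partial>\<rho>) = 1) \<and> (\<forall>y. (\<integral>x. k x y \<partial>\<rho>) = 1) \<and>
     (\<forall>x x' y. k x y \<le> exp (\<theta> * dist x x') * k x' y) \<and>
     (\<forall>x y y'. k x y \<le> exp (\<theta> * dist y y') * k x y')"

lemma balanced_kernel_transpose:
  assumes "balanced_kernel \<rho> \<theta> k" shows "balanced_kernel \<rho> \<theta> (\<lambda>x y. k y x)"
proof -
  have "continuous_on UNIV ((\<lambda>(x, y). k x y) \<circ> prod.swap)"
    using assms by (intro continuous_on_compose continuous_on_swap) (auto simp: balanced_kernel_def)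
  then have "continuous_on UNIV (\<lambda>(x, y). k y x)" by (simp add: comp_def case_prod_unfold)
  then show ?thesis using assms unfolding balanced_kernel_def by blast
qed

text \<open>
  On the ball the value \<open>k x y\<close> is controlled by \<open>k z y\<close> up to the factor \<open>exp (\<theta> * r)\<close>, and the
  integral of \<open>k z y\<close> over \<open>z\<close> is one.
\<close>

lemma balanced_kernel_bound:
  fixes \<rho> :: "'a::metric_space measure"
  assumes X: "compact (UNIV :: 'a set)" and \<rho>: "borel_prob \<rho>" and k: "balanced_kernel \<rho> \<theta> k"
    and "\<theta> \<ge> 0"
  shows "k x y * measure \<rho> (ball x r) \<le> exp (\<theta> * r)"
proof -
  interpret prob_space \<rho> using \<rho> by (simp add: borel_prob_def)
  have [measurable]: "ball x r \<in> sets \<rho>" using \<rho> by (simp add: borel_prob_def)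
  have "k x y * measure \<rho> (ball x r) = (\<integral>z. indicator (ball x r) z * k x y \<partial>\<rho>)" by simp
  also have "\<dots> \<le> (\<integral>z. exp (\<theta> * r) * k z y \<partial>\<rho>)"
  proof (intro integral_mono)
    have "continuous_on UNIV (\<lambda>z. k z y)"
      using k continuous_slices(2) by (auto simp: balanced_kernel_def)
    then show "integrable \<rho> (\<lambda>z. exp (\<theta> * r) * k z y)"
      by (intro borel_prob_integrable X \<rho> continuous_intros)
    show "indicator (ball x r) z * k x y \<le> exp (\<theta> * r) * k z y" for z
    proof (cases "z \<in> ball x r")
      case True
      then have "exp (\<theta> * dist x z) * k z y \<le> exp (\<theta> * r) * k z y"
        using k \<open>\<theta> \<ge> 0\<close> by (intro mult_right_mono) (auto simp: balanced_kernel_def less_imp_le mult_left_mono)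
      moreover have "k x y \<le> exp (\<theta> * dist x z) * k z y" using k by (auto simp: balanced_kernel_def)
      ultimately show ?thesis using True by simp
    qed (use k in \<open>auto simp: balanced_kernel_def less_imp_le\<close>)
  qed (auto intro: integrable_const_bound[of _ 1])
  also have "\<dots> = exp (\<theta> * r)" using k by (simp add: balanced_kernel_def)
  finally show ?thesis .
qed

text \<open>
  A multiplicative bound \<open>exp (\<theta> * d)\<close> on the variation becomes the additive bound \<open>k * \<theta> * d\<close>
  through \<open>1 - exp (- s) \<le> s\<close>, and \<open>balanced_kernel_bound\<close> controls the factor \<open>k\<close>.
\<close>

lemma balanced_kernel_lipschitz:
  fixes \<rho> :: "'a::metric_space measure"
  assumes X: "compact (UNIV :: 'a set)" and \<rho>: "borel_prob \<rho>" and k: "balanced_kernel \<rho> \<theta> k"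
    and \<theta>: "\<theta> \<ge> 0" and m: "0 < m" "m \<le> measure \<rho> (ball x r)"
  shows "\<bar>k x y - k x y'\<bar> \<le> exp (\<theta> * r) / m * \<theta> * dist y y'"
proof -
  have *: "k x y - k x y' \<le> exp (\<theta> * r) / m * \<theta> * dist y y'" for y y'
  proof -
    have pos: "0 < k x y" using k by (simp add: balanced_kernel_def)
    have "k x y * m \<le> exp (\<theta> * r)"
      using balanced_kernel_bound[OF X \<rho> k \<theta>, of x y r] mult_left_mono[OF m(2), of "k x y"] pos by linarith
    then have bound: "k x y \<le> exp (\<theta> * r) / m" using m by (simp add: field_simps)
    have "k x y \<le> exp (\<theta> * dist y y') * k x y'" using k by (simp add: balanced_kernel_def)
    then have "exp (- (\<theta> * dist y y')) * k x y \<le> exp (- (\<theta> * dist y y')) * (exp (\<theta> * dist y y') * k x y')"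
      by (intro mult_left_mono) auto
    then have "exp (- (\<theta> * dist y y')) * k x y \<le> k x y'"
      by (simp add: mult.assoc[symmetric] exp_add[symmetric])
    moreover have "(1 - \<theta> * dist y y') * k x y \<le> exp (- (\<theta> * dist y y')) * k x y"
      using exp_ge_add_one_self[of "- (\<theta> * dist y y')"] pos by (intro mult_right_mono) auto
    ultimately have "k x y - k x y' \<le> k x y * (\<theta> * dist y y')" by (simp add: algebra_simps)
    also have "\<dots> \<le> exp (\<theta> * r) / m * (\<theta> * dist y y')"
      using bound \<theta> by (intro mult_right_mono) auto
    finally show ?thesis by (simp add: mult_ac)
  qed
  show ?thesis using *[of y y'] *[of y' y] by (simp add: dist_commute abs_le_iff)
qed

text \<open>
  The soft minimum is monotone and commutes with adding constants. Applied to two slices of the cost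
  this transfers the Lipschitz constant of the cost to the potentials.
\<close>

lemma soft_min_mono:
  fixes f f' g :: "'a::topological_space \<Rightarrow> real"
  assumes X: "compact (UNIV :: 'a set)" "borel_prob \<rho>" and eps: "\<epsilon> > 0"
    and cont: "continuous_on UNIV f" "continuous_on UNIV f'" "continuous_on UNIV g"
    and le: "\<And>y. f y \<le> f' y + K"
  shows "- \<epsilon> * ln (\<integral>y. exp ((g y - f y) / \<epsilon>) \<partial>\<rho>) \<le> - \<epsilon> * ln (\<integral>y. exp ((g y - f' y) / \<epsilon>) \<partial>\<rho>) + K"
proof -
  have pos: "0 < (\<integral>y. exp ((g y - f y) / \<epsilon>) \<partial>\<rho>)" "0 < (\<integral>y. exp ((g y - f' y) / \<epsilon>) \<partial>\<rho>)"
    using eps cont by (auto intro!: integral_exp_pos X continuous_intros)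
  have "(\<integral>y. exp ((g y - f' y) / \<epsilon>) \<partial>\<rho>) \<le> (\<integral>y. exp (K / \<epsilon>) * exp ((g y - f y) / \<epsilon>) \<partial>\<rho>)"
  proof (intro integral_mono)
    show "exp ((g y - f' y) / \<epsilon>) \<le> exp (K / \<epsilon>) * exp ((g y - f y) / \<epsilon>)" for y
      using le[of y] eps by (simp add: exp_add[symmetric] add_divide_distrib[symmetric] divide_right_mono)
  qed (use eps in \<open>auto intro!: borel_prob_integrable X continuous_intros cont\<close>)
  then have "ln (\<integral>y. exp ((g y - f' y) / \<epsilon>) \<partial>\<rho>) \<le> ln (exp (K / \<epsilon>) * (\<integral>y. exp ((g y - f y) / \<epsilon>) \<partial>\<rho>))"
    using pos by (subst ln_le_cancel_iff) auto
  also have "\<dots> = K / \<epsilon> + ln (\<integral>y. exp ((g y - f y) / \<epsilon>) \<partial>\<rho>)" using pos by (simp add: ln_mult)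
  finally have "\<epsilon> * ln (\<integral>y. exp ((g y - f' y) / \<epsilon>) \<partial>\<rho>) \<le> \<epsilon> * (K / \<epsilon> + ln (\<integral>y. exp ((g y - f y) / \<epsilon>) \<partial>\<rho>))"
    using eps by (intro mult_left_mono) auto
  then show ?thesis using eps by (simp add: distrib_left)
qed

text \<open>
  The exponent is Lipschitz in each argument with constant \<open>2 * L / \<epsilon>\<close>: the cost and the
  potential contribute \<open>L\<close> each.
\<close>

lemma gibbs_balanced:
  fixes c :: "'a::metric_space \<Rightarrow> 'a \<Rightarrow> real"
  assumes X: "compact (UNIV :: 'a set)" and \<rho>: "borel_prob \<rho>"
    and c: "continuous_on UNIV (\<lambda>(x, y). c x y)" "\<And>x y. c x y = c y x"
    and L: "\<And>x x' y. \<bar>c x y - c x' y\<bar> \<le> L * dist x x'"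
    and eps: "\<epsilon> > 0" and pot: "entropic_potentials c \<epsilon> \<rho> \<rho> \<alpha> \<beta>"
  shows "balanced_kernel \<rho> (2 * L / \<epsilon>) (\<lambda>x y. exp ((\<alpha> x + \<beta> y - c x y) / \<epsilon>))"
proof -
  have cont: "continuous_on UNIV \<alpha>" "continuous_on UNIV \<beta>"
    and \<alpha>: "\<And>x. \<alpha> x = - \<epsilon> * ln (\<integral>y. exp ((\<beta> y - c x y) / \<epsilon>) \<partial>\<rho>)"
    and \<beta>: "\<And>y. \<beta> y = - \<epsilon> * ln (\<integral>x. exp ((\<alpha> x - c x y) / \<epsilon>) \<partial>\<rho>)"
    using pot unfolding entropic_potentials_def by blast+
  note sl = continuous_slices[OF c(1)]
  have L1: "c x y \<le> c x' y + L * dist x x'" for x x' y using L[of x y x'] by linarith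
  have L2: "c x y \<le> c x y' + L * dist y y'" for x y y' using L[of y x y'] by (simp add: c(2)[of x])
  have \<alpha>L: "\<alpha> x \<le> \<alpha> x' + L * dist x x'" for x x'
    unfolding \<alpha> by (rule soft_min_mono[OF X \<rho> eps sl(1) sl(1) cont(2) L1])
  have \<beta>L: "\<beta> y \<le> \<beta> y' + L * dist y y'" for y y'
    unfolding \<beta> by (rule soft_min_mono[OF X \<rho> eps sl(2) sl(2) cont(1) L2])
  have "exp ((\<alpha> x + \<beta> y - c x y) / \<epsilon>) \<le> exp (2 * L / \<epsilon> * dist x x') * exp ((\<alpha> x' + \<beta> y - c x' y) / \<epsilon>)" for x x' y
  proof -
    have "\<alpha> x + \<beta> y - c x y \<le> 2 * L * dist x x' + (\<alpha> x' + \<beta> y - c x' y)"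
      using \<alpha>L[of x x'] L1[of x' y x] by (simp add: dist_commute)
    then show ?thesis
      using eps by (simp add: exp_add[symmetric] add_divide_distrib[symmetric] divide_right_mono)
  qed
  moreover have "exp ((\<alpha> x + \<beta> y - c x y) / \<epsilon>) \<le> exp (2 * L / \<epsilon> * dist y y') * exp ((\<alpha> x + \<beta> y' - c x y') / \<epsilon>)" for x y y'
  proof -
    have "\<alpha> x + \<beta> y - c x y \<le> 2 * L * dist y y' + (\<alpha> x + \<beta> y' - c x y')"
      using \<beta>L[of y y'] L2[of x y' y] by (simp add: dist_commute)
    then show ?thesis
      using eps by (simp add: exp_add[symmetric] add_divide_distrib[symmetric] divide_right_mono)
  qed
  moreover have "(\<integral>y. exp ((\<alpha> x + \<beta> y - c x y) / \<epsilon>) \<partial>\<rho>) = 1" for x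
    by (rule gibbs_normalized[OF X \<rho> eps sl(1) cont(2) \<alpha>])
  moreover have "(\<integral>x. exp ((\<alpha> x + \<beta> y - c x y) / \<epsilon>) \<partial>\<rho>) = 1" for y
    using gibbs_normalized[OF X \<rho> eps sl(2) cont(1) \<beta>, of y] by (simp add: add_ac)
  moreover have "continuous_on UNIV (\<lambda>(x, y). exp ((\<alpha> x + \<beta> y - c x y) / \<epsilon>))"
    by (rule gibbs_continuous[OF c(1) cont])
  ultimately show ?thesis by (simp add: balanced_kernel_def)
qed

lemma entropic_kernel_balanced:
  fixes c :: "'a::metric_space \<Rightarrow> 'a \<Rightarrow> real"
  assumes "compact (UNIV :: 'a set)" "borel_prob \<rho>"
    and "continuous_on UNIV (\<lambda>(x, y). c x y)" "\<And>x y. c x y = c y x"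
    and "\<And>x x' y. \<bar>c x y - c x' y\<bar> \<le> L * dist x x'"
    and "\<epsilon> > 0" and pot: "\<exists>\<alpha> \<beta>. entropic_potentials c \<epsilon> \<rho> \<rho> \<alpha> \<beta>"
  shows "balanced_kernel \<rho> (2 * L / \<epsilon>) (entropic_kernel c \<epsilon> \<rho> \<rho>)"
proof -
  have "\<exists>k \<alpha> \<beta>. entropic_potentials c \<epsilon> \<rho> \<rho> \<alpha> \<beta> \<and> k = (\<lambda>x y. exp ((\<alpha> x + \<beta> y - c x y) / \<epsilon>))"
    using pot by blast
  from someI_ex[OF this] obtain \<alpha> \<beta> where "entropic_potentials c \<epsilon> \<rho> \<rho> \<alpha> \<beta>"
    "entropic_kernel c \<epsilon> \<rho> \<rho> = (\<lambda>x y. exp ((\<alpha> x + \<beta> y - c x y) / \<epsilon>))"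
    unfolding entropic_kernel_def by blast
  then show ?thesis using gibbs_balanced[of \<rho> c L \<epsilon> \<alpha> \<beta>] assms by simp
qed

section \<open>Empirical measures and the transfer kernel\<close>

lemma borel_prob_empirical:
  assumes "N \<ge> 1" shows "borel_prob (empirical N z)"
proof -
  have "{..<N} \<noteq> {}" using assms by (auto simp: lessThan_empty_iff)
  then interpret prob_space "uniform_count_measure {..<N}"
    by (intro prob_space_uniform_count_measure) auto
  show ?thesis unfolding borel_prob_def empirical_def
    by (auto intro!: prob_space_distr simp: measurable_def space_uniform_count_measure sets_uniform_count_measure)
qed

lemma distr_empirical:
  assumes "g \<in> borel_measurable borel"
  shows "distr (empirical N z) borel g = empirical N (g \<circ> z)"
  unfolding empirical_def
  by (rule distr_distr)
    (use assms in \<open>auto simp: measurable_def space_uniform_count_measure sets_uniform_count_measure\<close>)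

lemma
  fixes f :: "'a::topological_space \<Rightarrow> real"
  assumes "f \<in> borel_measurable borel"
  shows integral_empirical: "(\<integral>x. f x \<partial>empirical N z) = (\<Sum>i<N. f (z i)) / N"
    and integrable_empirical: "integrable (empirical N z) f"
proof -
  have z: "z \<in> measurable (uniform_count_measure {..<N}) borel"
    by (auto simp: measurable_def space_uniform_count_measure sets_uniform_count_measure)
  show "(\<integral>x. f x \<partial>empirical N z) = (\<Sum>i<N. f (z i)) / N"
    unfolding empirical_def using assms
    by (simp add: integral_distr[OF z] lebesgue_integral_point_measure_finite integral_uniform_count_measure)
  show "integrable (empirical N z) f"
    unfolding empirical_def using assms
    by (subst integrable_distr_eq[OF z]) (simp_all add: uniform_count_measure_def integrable_point_measure_finite)
qed

text \<open>
  A solution of the scaling problem on the sample points prescribes the potential there, and one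
  application of the soft minimum extends it to the whole space. The same function serves as both
  potentials because the cost is symmetric.
\<close>

lemma entropic_potentials_empirical:
  fixes c :: "'a::second_countable_topology \<Rightarrow> 'a \<Rightarrow> real"
  assumes X: "compact (UNIV :: 'a set)" and N: "N \<ge> 1"
    and c: "continuous_on UNIV (\<lambda>(x, y). c x y)" "\<And>x y. c x y = c y x" "\<And>x. c x x = 0"
    and eps: "\<epsilon> > 0"
  shows "\<exists>\<alpha> \<beta>. entropic_potentials c \<epsilon> (empirical N z) (empirical N z) \<alpha> \<beta>"
proof -
  obtain a where a: "\<And>i. i < N \<Longrightarrow> (\<Sum>j<N. exp (a i + a j - c (z i) (z j) / \<epsilon>)) = N"
    using symmetric_scaling_exists[OF N, of "\<lambda>i j. c (z i) (z j) / \<epsilon>"] c by auto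
  define S where "S x = (\<Sum>j<N. exp (a j - c x (z j) / \<epsilon>)) / N" for x
  define \<alpha> where "\<alpha> x = - \<epsilon> * ln (S x)" for x
  have "0 < S x" for x
    unfolding S_def using N by (intro divide_pos_pos sum_pos) (auto simp: lessThan_empty_iff)
  moreover have "continuous_on UNIV S"
    unfolding S_def using N eps
    by (intro continuous_intros continuous_slices(2)[OF c(1)]) auto
  ultimately have cont: "continuous_on UNIV \<alpha>"
    unfolding \<alpha>_def by (intro continuous_intros) (auto simp: less_imp_neq[symmetric])
  have \<alpha>z: "\<alpha> (z i) = \<epsilon> * a i" if "i < N" for i
  proof -
    have "exp (a i) * (\<Sum>j<N. exp (a j - c (z i) (z j) / \<epsilon>)) = N"
      using a[OF that] by (simp add: sum_distrib_left exp_add[symmetric] add_diff_eq)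
    then have "S (z i) = exp (- a i)" using N by (simp add: S_def exp_minus field_simps)
    then show ?thesis by (simp add: \<alpha>_def)
  qed
  have eq: "\<alpha> x = - \<epsilon> * ln (\<integral>y. exp ((\<alpha> y - c x y) / \<epsilon>) \<partial>empirical N z)" for x
  proof -
    have "continuous_on UNIV (\<lambda>y. exp ((\<alpha> y - c x y) / \<epsilon>))"
      using eps by (intro continuous_intros cont continuous_slices(1)[OF c(1)]) auto
    then have "(\<integral>y. exp ((\<alpha> y - c x y) / \<epsilon>) \<partial>empirical N z) = (\<Sum>i<N. exp ((\<alpha> (z i) - c x (z i)) / \<epsilon>)) / N"
      by (intro integral_empirical borel_measurable_continuous_onI)
    also have "\<dots> = S x"
      unfolding S_def using eps by (auto intro!: sum.cong arg_cong[where f="\<lambda>s. s / N"] simp: \<alpha>z diff_divide_distrib)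
    finally show ?thesis by (simp add: \<alpha>_def)
  qed
  have eq': "\<alpha> x = - \<epsilon> * ln (\<integral>y. exp ((\<alpha> y - c y x) / \<epsilon>) \<partial>empirical N z)" for x
    by (subst c(2)) (rule eq)
  have b: "borel_prob (empirical N z)" by (rule borel_prob_empirical[OF N])
  show ?thesis using entropic_potentialsI[OF X b b c(1) eps cont cont eq eq'] by blast
qed

lemma transfer_kernel_empirical:
  fixes c :: "'a::{second_countable_topology,metric_space} \<Rightarrow> 'a \<Rightarrow> real" and N :: nat and \<epsilon> :: real
  defines "p \<equiv> \<lambda>a. entropic_kernel c \<epsilon> (empirical N a) (empirical N a)"
  assumes "continuous_on UNIV (\<lambda>(x, y). p (fst \<circ> z) x y)" "continuous_on UNIV (\<lambda>(x, y). p (snd \<circ> z) x y)"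
  shows "transfer_kernel c \<epsilon> (empirical N z) x y
      = (\<Sum>i<N. p (fst \<circ> z) x (fst (z i)) * p (snd \<circ> z) (snd (z i)) y) / N"
proof -
  have *: "continuous_on UNIV (\<lambda>w. p (fst \<circ> z) x (fst w) * p (snd \<circ> z) (snd w) y)"
    by (intro continuous_intros continuous_on_compose2[OF continuous_slices(1)[OF assms(2)]]
        continuous_on_compose2[OF continuous_slices(2)[OF assms(3)]]) auto
  show ?thesis
    using integral_empirical[OF borel_measurable_continuous_onI[OF *], of N z]
    unfolding transfer_kernel_def Let_def case_prod_unfold
    by (simp add: distr_empirical borel_measurable_continuous_onI continuous_on_fst continuous_on_snd
        continuous_on_id p_def)
qed

text \<open>
  In \<open>y\<close> the kernel \<open>t x y\<close> is a weighted mean of the functions \<open>y \<mapsto> k\<^sub>\<nu> y' y\<close>, with weights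
  \<open>k\<^sub>\<mu> x x'\<close> of mean one, so it inherits their Lipschitz constant. In \<open>x\<close> the two kernels exchange
  roles.
\<close>

lemma transfer_kernel_lipschitz:
  fixes c :: "'a::{metric_space,second_countable_topology} \<Rightarrow> 'a \<Rightarrow> real" and z :: "nat \<Rightarrow> 'a \<times> 'a"
    and N :: nat and \<epsilon> :: real
  defines "t \<equiv> transfer_kernel c \<epsilon> (empirical N z)"
  assumes X: "compact (UNIV :: 'a set)" and N: "N \<ge> 1"
    and c: "continuous_on UNIV (\<lambda>(x, y). c x y)" "\<And>x y. c x y = c y x" "\<And>x. c x x = 0"
    and L: "\<And>x x' y. \<bar>c x y - c x' y\<bar> \<le> L * dist x x'" and "L \<ge> 0"
    and eps: "\<epsilon> > 0" and m: "m > 0"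
  shows "(\<And>i. i < N \<Longrightarrow> m \<le> measure (empirical N (snd \<circ> z)) (ball (snd (z i)) \<epsilon>)) \<Longrightarrow>
      \<bar>t x y - t x y'\<bar> \<le> exp (2 * L) / m * (2 * L / \<epsilon>) * dist y y'"
    and "(\<And>i. i < N \<Longrightarrow> m \<le> measure (empirical N (fst \<circ> z)) (ball (fst (z i)) \<epsilon>)) \<Longrightarrow>
      \<bar>t x y - t x' y\<bar> \<le> exp (2 * L) / m * (2 * L / \<epsilon>) * dist x x'"
    and "continuous_on UNIV (\<lambda>x. t x y)" and "continuous_on UNIV (t x)"
proof -
  define p where "p a = entropic_kernel c \<epsilon> (empirical N a) (empirical N a)" for a
  define \<Lambda> where "\<Lambda> = exp (2 * L) / m * (2 * L / \<epsilon>)"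
  have emp: "borel_prob (empirical N a)" for a :: "nat \<Rightarrow> 'a" using N by (rule borel_prob_empirical)
  have p: "balanced_kernel (empirical N a) (2 * L / \<epsilon>) (p a)" for a
    unfolding p_def
    by (intro entropic_kernel_balanced entropic_potentials_empirical emp X N c L eps)
  then have pc: "continuous_on UNIV (\<lambda>(x, y). p a x y)" for a by (simp add: balanced_kernel_def)
  have t: "t x y = (\<Sum>i<N. p (fst \<circ> z) x (fst (z i)) * p (snd \<circ> z) (snd (z i)) y) / N" for x y
    unfolding t_def p_def by (rule transfer_kernel_empirical[OF pc[unfolded p_def] pc[unfolded p_def]])
  have pos: "0 \<le> p a x y" for a x y using p by (simp add: balanced_kernel_def less_imp_le)
  have rows: "(\<Sum>i<N. p a x (a i)) / N = 1" for a x
    using p[of a] integral_empirical[OF borel_measurable_continuous_onI[OF continuous_slices(1)[OF pc]], where z=a]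
    by (simp add: balanced_kernel_def)
  have cols: "(\<Sum>i<N. p a (a i) y) / N = 1" for a y
    using p[of a] integral_empirical[OF borel_measurable_continuous_onI[OF continuous_slices(2)[OF pc]], where z=a]
    by (simp add: balanced_kernel_def)
  have average: "\<bar>(\<Sum>i<N. w i * f i) / N - (\<Sum>i<N. w i * g i) / N\<bar> \<le> K"
    if "\<And>i. i < N \<Longrightarrow> 0 \<le> w i" "(\<Sum>i<N. w i) / N = 1" "\<And>i. i < N \<Longrightarrow> \<bar>f i - g i\<bar> \<le> K"
    for w f g :: "nat \<Rightarrow> real" and K
  proof -
    have "\<bar>(\<Sum>i<N. w i * f i) - (\<Sum>i<N. w i * g i)\<bar> = \<bar>\<Sum>i<N. w i * (f i - g i)\<bar>"
      by (simp add: right_diff_distrib sum_subtractf)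
    also have "\<dots> \<le> (\<Sum>i<N. w i * K)"
      by (rule order_trans[OF sum_abs sum_mono]) (use that in \<open>auto simp: abs_mult intro!: mult_left_mono\<close>)
    also have "\<dots> = K * N" using that(2) N by (simp add: field_simps flip: sum_distrib_right sum_distrib_left)
    finally show ?thesis using N by (simp add: diff_divide_distrib[symmetric] field_simps)
  qed
  have \<theta>: "0 \<le> 2 * L / \<epsilon>" "2 * L / \<epsilon> * \<epsilon> = 2 * L" using eps \<open>L \<ge> 0\<close> by auto
  show "\<bar>t x y - t x y'\<bar> \<le> \<Lambda> * dist y y'"
    if "\<And>i. i < N \<Longrightarrow> m \<le> measure (empirical N (snd \<circ> z)) (ball (snd (z i)) \<epsilon>)"
    unfolding t \<Lambda>_def
    using pos rows[of "fst \<circ> z"] balanced_kernel_lipschitz[OF X emp p \<theta>(1) m that] \<theta>(2)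
    by (intro average) (auto simp: mult.assoc)
  show "\<bar>t x y - t x' y\<bar> \<le> \<Lambda> * dist x x'"
    if "\<And>i. i < N \<Longrightarrow> m \<le> measure (empirical N (fst \<circ> z)) (ball (fst (z i)) \<epsilon>)"
    unfolding t \<Lambda>_def mult.commute[of "p (fst \<circ> z) _ _"]
    using pos cols[of "snd \<circ> z"] balanced_kernel_lipschitz[OF X emp balanced_kernel_transpose[OF p] \<theta>(1) m that] \<theta>(2)
    by (intro average) (auto simp: mult.assoc)
  show "continuous_on UNIV (\<lambda>x. t x y)" "continuous_on UNIV (t x)"
    unfolding t[abs_def] using N by (auto intro!: continuous_intros continuous_slices[OF pc])
qed

section \<open>Conditional means along a coupling\<close>

lemma L2_spaceD:
  assumes "f \<in> L2_space M"
  shows "f \<in> borel_measurable M" "integrable M (\<lambda>x. (f x)\<^sup>2)"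
  using assms by (auto simp: L2_space_def)

lemma L2_mult_integrable:
  assumes "f \<in> borel_measurable M" "g \<in> borel_measurable M"
    and "integrable M (\<lambda>x. (f x)\<^sup>2)" "integrable M (\<lambda>x. (g x)\<^sup>2)"
  shows "integrable M (\<lambda>x. f x * g x :: real)"
proof (rule Bochner_Integration.integrable_bound)
  show "integrable M (\<lambda>x. (f x)\<^sup>2 + (g x)\<^sup>2)" using assms by simp
  show "AE x in M. norm (f x * g x) \<le> norm ((f x)\<^sup>2 + (g x)\<^sup>2)"
  proof (intro AE_I2)
    fix x
    have "2 * \<bar>f x * g x\<bar> \<le> (f x)\<^sup>2 + (g x)\<^sup>2"
      using sum_squares_bound[of "\<bar>f x\<bar>" "\<bar>g x\<bar>"] by (simp add: abs_mult)
    then show "norm (f x * g x) \<le> norm ((f x)\<^sup>2 + (g x)\<^sup>2)" by simp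
  qed
qed (use assms in simp)

lemma L2_space_diff:
  assumes "f \<in> L2_space M" "g \<in> L2_space M" shows "(\<lambda>x. f x - g x) \<in> L2_space M"
proof -
  note L2_spaceD[OF assms(1)] L2_spaceD[OF assms(2)]
  then have "integrable M (\<lambda>x. (f x)\<^sup>2 + (g x)\<^sup>2 - 2 * (f x * g x))"
    using L2_mult_integrable[of f M g] by simp
  then have "integrable M (\<lambda>x. (f x - g x)\<^sup>2)" by (simp add: power2_diff mult.assoc)
  then show ?thesis using L2_spaceD(1)[OF assms(1)] L2_spaceD(1)[OF assms(2)] by (simp add: L2_space_def)
qed

lemma coupling_facts:
  assumes "\<gamma> \<in> couplings \<mu> \<nu>"
  shows "prob_space \<gamma>" "fst \<in> measurable \<gamma> borel" "snd \<in> measurable \<gamma> borel"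
    "distr \<gamma> borel fst = \<mu>" "distr \<gamma> borel snd = \<nu>" "sets \<mu> = sets borel" "sets \<nu> = sets borel"
proof -
  show "prob_space \<gamma>" "distr \<gamma> borel fst = \<mu>" "distr \<gamma> borel snd = \<nu>"
    using assms by (auto simp: couplings_def borel_prob_def)
  have sets: "sets \<gamma> = sets borel" using assms by (auto simp: couplings_def borel_prob_def)
  show "fst \<in> measurable \<gamma> borel" "snd \<in> measurable \<gamma> borel"
    unfolding measurable_cong_sets[OF sets refl]
    by (auto intro!: borel_measurable_continuous_onI continuous_intros)
  show "sets \<mu> = sets borel" "sets \<nu> = sets borel" using assms by (auto simp: couplings_def)
qed

text \<open>
  The conditional mean \<open>h\<close> of \<open>g (snd p)\<close> given \<open>fst p\<close>. It is the density with respect to \<open>\<mu>\<close> of the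
  first marginal of the coupling weighted by \<open>g\<close>. The identity holds for every measurable \<open>f\<close>, so
  only the square integrability of \<open>h\<close> has to be proved, and testing with truncations of \<open>h\<close> itself
  does this.
\<close>

lemma coupling_conditional_nonneg:
  assumes \<gamma>: "\<gamma> \<in> couplings \<mu> \<nu>" and g: "g \<in> L2_space \<nu>" and g0: "\<And>y. 0 \<le> g y"
  shows "\<exists>h\<in>L2_space \<mu>. \<forall>f\<in>L2_space \<mu>. (\<integral>x. f x * h x \<partial>\<mu>) = (\<integral>p. f (fst p) * g (snd p) \<partial>\<gamma>)"
proof -
  note cf = coupling_facts[OF \<gamma>]
  interpret \<gamma>: prob_space \<gamma> by (rule cf)
  interpret \<mu>: prob_space \<mu> unfolding cf(4)[symmetric] by (rule \<gamma>.prob_space_distr[OF cf(2)])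
  interpret \<nu>: prob_space \<nu> unfolding cf(5)[symmetric] by (rule \<gamma>.prob_space_distr[OF cf(3)])
  note [measurable] = cf(2,3)
  note [measurable_cong] = cf(6,7)
  have gm [measurable]: "g \<in> borel_measurable borel"
    using L2_spaceD(1)[OF g] measurable_cong_sets[OF cf(7) refl] by auto
  have g2: "integrable \<gamma> (\<lambda>p. (g (snd p))\<^sup>2)"
    using L2_spaceD(2)[OF g] integrable_distr_eq[OF cf(3), of "\<lambda>y. (g y)\<^sup>2"] cf(5) by simp
  have g1: "integrable \<gamma> (\<lambda>p. g (snd p))"
    using L2_mult_integrable[of "\<lambda>p. g (snd p)" \<gamma> "\<lambda>_. 1"] g2 by simp
  define \<eta> where "\<eta> = distr (density \<gamma> (\<lambda>p. ennreal (g (snd p)))) borel fst"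
  have sets_\<eta>: "sets \<eta> = sets \<mu>" by (simp add: \<eta>_def cf)
  have "emeasure \<eta> (space \<eta>) = (\<integral>\<^sup>+p. ennreal (g (snd p)) \<partial>\<gamma>)"
    unfolding \<eta>_def by (subst emeasure_distr) (auto simp: emeasure_density intro!: nn_integral_cong split: split_indicator)
  also have "\<dots> < \<infinity>"
    using g1 g0 by (simp add: nn_integral_eq_integral)
  finally interpret \<eta>: finite_measure \<eta> by (intro finite_measureI) auto
  have ac: "absolutely_continuous \<mu> \<eta>"
    unfolding absolutely_continuous_def
  proof (intro subsetI)
    fix A assume "A \<in> null_sets \<mu>"
    then have A: "A \<in> sets borel" "emeasure \<mu> A = 0" by (auto simp: null_sets_def cf)
    then have "emeasure \<gamma> (fst -` A \<inter> space \<gamma>) = 0"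
      using emeasure_distr[OF cf(2) A(1)] cf(4) by simp
    then have "AE p in \<gamma>. p \<notin> fst -` A \<inter> space \<gamma>"
      using A(1) by (intro AE_not_in) (auto simp: null_sets_def)
    then have "(\<integral>\<^sup>+p. ennreal (g (snd p)) * indicator (fst -` A \<inter> space \<gamma>) p \<partial>\<gamma>) = 0"
      using A(1) by (subst nn_integral_0_iff_AE) auto
    then show "A \<in> null_sets \<eta>"
      using A(1) by (auto simp: null_sets_def \<eta>_def emeasure_distr emeasure_density)
  qed
  obtain h where h [measurable]: "h \<in> borel_measurable \<mu>" and RN: "AE x in \<mu>. RN_deriv \<mu> \<eta> x = ennreal (h x)"
    and h0: "\<And>x. 0 \<le> h x"
    using \<mu>.real_RN_deriv[OF \<eta>.finite_measure_axioms ac sets_\<eta>] by metis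
  have "density \<mu> (\<lambda>x. ennreal (h x)) = density \<mu> (RN_deriv \<mu> \<eta>)"
    by (rule density_cong) (use RN in auto)
  also have "\<dots> = \<eta>" by (rule \<mu>.density_RN_deriv[OF ac sets_\<eta>])
  finally have \<eta>h: "density \<mu> (\<lambda>x. ennreal (h x)) = \<eta>" .
  have eq: "(\<integral>x. f x * h x \<partial>\<mu>) = (\<integral>p. f (fst p) * g (snd p) \<partial>\<gamma>)"
    if [measurable]: "f \<in> borel_measurable borel" for f
  proof -
    have "(\<integral>x. f x * h x \<partial>\<mu>) = (\<integral>x. f x \<partial>\<eta>)"
      unfolding \<eta>h[symmetric] using h0 by (subst integral_density) (auto simp: mult_ac)
    also have "\<dots> = (\<integral>p. f (fst p) * g (snd p) \<partial>\<gamma>)"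
      unfolding \<eta>_def using g0
      by (subst integral_distr) (auto simp: integral_density mult_ac)
    finally show ?thesis .
  qed
  have "(\<integral>\<^sup>+x. ennreal (h x) \<partial>\<mu>) = emeasure \<eta> (space \<eta>)"
    unfolding \<eta>h[symmetric] by (subst emeasure_density) (auto intro!: nn_integral_cong)
  then have h1: "integrable \<mu> h"
    using h0 by (simp add: integrable_iff_bounded \<eta>.emeasure_eq_measure)
  define G where "G = (\<integral>p. (g (snd p))\<^sup>2 \<partial>\<gamma>)"
  \<comment> \<open>For \<open>k = min h n\<close> the identity and \<open>k * g \<le> (k\<^sup>2 + g\<^sup>2) / 2\<close> give
    \<open>\<integral> k\<^sup>2 \<le> (\<integral> k\<^sup>2 + G) / 2\<close>; boundedness of \<open>k\<close> allows absorbing the first term.\<close>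
  have trunc: "(\<integral>\<^sup>+x. ennreal ((min (h x) (real n))\<^sup>2) \<partial>\<mu>) \<le> ennreal G" for n
  proof -
    define k where "k x = min (h x) (real n)" for x
    have km [measurable]: "k \<in> borel_measurable borel"
      unfolding k_def using h measurable_cong_sets[OF cf(6) refl] by auto
    have k0: "0 \<le> k x" "k x \<le> n" "k x \<le> h x" for x using h0 by (auto simp: k_def)
    have k2: "integrable \<mu> (\<lambda>x. (k x)\<^sup>2)"
      using k0 by (intro \<mu>.integrable_const_bound[of _ "(real n)\<^sup>2"]) (auto intro!: power_mono)
    have k2': "integrable \<gamma> (\<lambda>p. (k (fst p))\<^sup>2)"
      "(\<integral>p. (k (fst p))\<^sup>2 \<partial>\<gamma>) = (\<integral>x. (k x)\<^sup>2 \<partial>\<mu>)"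
      using k2 integrable_distr_eq[OF cf(2), of "\<lambda>y. (k y)\<^sup>2"] integral_distr[OF cf(2), of "\<lambda>y. (k y)\<^sup>2"] cf(4)
      by simp_all
    have kg: "integrable \<gamma> (\<lambda>p. k (fst p) * g (snd p))"
      using k2' g2 by (intro L2_mult_integrable) auto
    have "(\<integral>x. (k x)\<^sup>2 \<partial>\<mu>) \<le> (\<integral>x. k x * h x \<partial>\<mu>)"
    proof (rule integral_mono[OF k2])
      show "integrable \<mu> (\<lambda>x. k x * h x)"
        by (rule Bochner_Integration.integrable_bound[OF integrable_mult_right[OF h1, of n]])
          (use k0 h0 in \<open>auto simp: abs_mult intro!: mult_right_mono\<close>)
      show "(k x)\<^sup>2 \<le> k x * h x" for x
        using k0[of x] by (simp add: power2_eq_square mult_left_mono)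
    qed
    also have "\<dots> = (\<integral>p. k (fst p) * g (snd p) \<partial>\<gamma>)" by (rule eq) measurable
    also have "\<dots> \<le> (\<integral>p. ((k (fst p))\<^sup>2 + (g (snd p))\<^sup>2) / 2 \<partial>\<gamma>)"
    proof (rule integral_mono[OF kg])
      show "k (fst p) * g (snd p) \<le> ((k (fst p))\<^sup>2 + (g (snd p))\<^sup>2) / 2" for p
        using sum_squares_bound[of "k (fst p)" "g (snd p)"] by simp
    qed (use k2' g2 in simp)
    also have "\<dots> = ((\<integral>x. (k x)\<^sup>2 \<partial>\<mu>) + G) / 2"
      using k2' g2 by (simp add: G_def)
    finally have "(\<integral>x. (k x)\<^sup>2 \<partial>\<mu>) \<le> G" by simp
    then show ?thesis using k2 by (simp add: nn_integral_eq_integral k_def[symmetric] ennreal_leI)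
  qed
  have "(\<integral>\<^sup>+x. ennreal ((h x)\<^sup>2) \<partial>\<mu>) = (\<integral>\<^sup>+x. liminf (\<lambda>n. ennreal ((min (h x) (real n))\<^sup>2)) \<partial>\<mu>)"
  proof (intro nn_integral_cong)
    fix x
    have "eventually (\<lambda>n. real n \<ge> h x) sequentially"
    proof -
      obtain n\<^sub>0 where "h x \<le> real n\<^sub>0" using real_arch_simple by blast
      then show ?thesis by (intro eventually_sequentiallyI[of n\<^sub>0]) linarith
    qed
    then have "eventually (\<lambda>n. ennreal ((min (h x) (real n))\<^sup>2) = ennreal ((h x)\<^sup>2)) sequentially"
      by eventually_elim simp
    then have "(\<lambda>n. ennreal ((min (h x) (real n))\<^sup>2)) \<longlonglongrightarrow> ennreal ((h x)\<^sup>2)"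
      by (rule tendsto_eventually)
    then show "ennreal ((h x)\<^sup>2) = liminf (\<lambda>n. ennreal ((min (h x) (real n))\<^sup>2))"
      by (intro lim_imp_Liminf[symmetric]) auto
  qed
  also have "\<dots> \<le> liminf (\<lambda>n. \<integral>\<^sup>+x. ennreal ((min (h x) (real n))\<^sup>2) \<partial>\<mu>)"
    by (rule nn_integral_liminf) simp
  also have "\<dots> \<le> liminf (\<lambda>_::nat. ennreal G)" by (intro Liminf_mono always_eventually allI trunc)
  also have "\<dots> < \<infinity>" by (simp add: Liminf_const)
  finally have "integrable \<mu> (\<lambda>x. (h x)\<^sup>2)" by (auto simp: integrable_iff_bounded)
  then have "h \<in> L2_space \<mu>" by (simp add: L2_space_def)
  moreover have "f \<in> borel_measurable borel" if "f \<in> L2_space \<mu>" for f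
    using L2_spaceD(1)[OF that] measurable_cong_sets[OF cf(6) refl] by auto
  ultimately show ?thesis using eq by blast
qed

lemma coupling_L2_integrable:
  assumes \<gamma>: "\<gamma> \<in> couplings \<mu> \<nu>" and f: "f \<in> L2_space \<mu>" and g: "g \<in> L2_space \<nu>"
  shows "integrable \<gamma> (\<lambda>p. f (fst p) * g (snd p))"
    and "integrable \<gamma> (\<lambda>p. (f (fst p))\<^sup>2)" and "integrable \<gamma> (\<lambda>p. (g (snd p))\<^sup>2)"
    and "(\<lambda>p. f (fst p)) \<in> borel_measurable \<gamma>" "(\<lambda>p. g (snd p)) \<in> borel_measurable \<gamma>"
proof -
  note cf = coupling_facts[OF \<gamma>]
  note [measurable] = cf(2,3)
  have [measurable]: "f \<in> borel_measurable borel" "g \<in> borel_measurable borel"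
    using L2_spaceD(1)[OF f] L2_spaceD(1)[OF g] measurable_cong_sets[OF cf(6) refl] measurable_cong_sets[OF cf(7) refl]
    by auto
  show m: "(\<lambda>p. f (fst p)) \<in> borel_measurable \<gamma>" "(\<lambda>p. g (snd p)) \<in> borel_measurable \<gamma>"
    by measurable
  show i: "integrable \<gamma> (\<lambda>p. (f (fst p))\<^sup>2)" "integrable \<gamma> (\<lambda>p. (g (snd p))\<^sup>2)"
    using L2_spaceD(2)[OF f] L2_spaceD(2)[OF g] cf(4,5)
      integrable_distr_eq[OF cf(2), of "\<lambda>y. (f y)\<^sup>2"] integrable_distr_eq[OF cf(3), of "\<lambda>y. (g y)\<^sup>2"] by auto
  show "integrable \<gamma> (\<lambda>p. f (fst p) * g (snd p))"
    using m i by (rule L2_mult_integrable)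
qed

lemma coupling_conditional:
  assumes \<gamma>: "\<gamma> \<in> couplings \<mu> \<nu>" and g: "g \<in> L2_space \<nu>"
  shows "\<exists>h\<in>L2_space \<mu>. \<forall>f\<in>L2_space \<mu>. (\<integral>x. f x * h x \<partial>\<mu>) = (\<integral>p. f (fst p) * g (snd p) \<partial>\<gamma>)"
proof -
  define gp where "gp y = max (g y) 0" for y
  define gn where "gn y = max (- g y) 0" for y
  have sq: "(gp y)\<^sup>2 \<le> (g y)\<^sup>2" "(gn y)\<^sup>2 \<le> (g y)\<^sup>2" for y by (auto simp: gp_def gn_def max_def)
  have "gp \<in> borel_measurable \<nu>" "gn \<in> borel_measurable \<nu>"
    unfolding gp_def gn_def using L2_spaceD(1)[OF g] by auto
  then have pn: "gp \<in> L2_space \<nu>" "gn \<in> L2_space \<nu>"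
    using sq by (auto simp: L2_space_def intro!: Bochner_Integration.integrable_bound[OF L2_spaceD(2)[OF g]])
  obtain hp where hp: "hp \<in> L2_space \<mu>" "\<forall>f\<in>L2_space \<mu>. (\<integral>x. f x * hp x \<partial>\<mu>) = (\<integral>p. f (fst p) * gp (snd p) \<partial>\<gamma>)"
    using coupling_conditional_nonneg[OF \<gamma> pn(1)] by (auto simp: gp_def)
  obtain hn where hn: "hn \<in> L2_space \<mu>" "\<forall>f\<in>L2_space \<mu>. (\<integral>x. f x * hn x \<partial>\<mu>) = (\<integral>p. f (fst p) * gn (snd p) \<partial>\<gamma>)"
    using coupling_conditional_nonneg[OF \<gamma> pn(2)] by (auto simp: gn_def)
  have "(\<integral>x. f x * (hp x - hn x) \<partial>\<mu>) = (\<integral>p. f (fst p) * g (snd p) \<partial>\<gamma>)" if f: "f \<in> L2_space \<mu>" for f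
  proof -
    have "(\<integral>x. f x * (hp x - hn x) \<partial>\<mu>) = (\<integral>x. f x * hp x \<partial>\<mu>) - (\<integral>x. f x * hn x \<partial>\<mu>)"
      unfolding right_diff_distrib
      by (intro Bochner_Integration.integral_diff L2_mult_integrable L2_spaceD f hp hn)
    also have "\<dots> = (\<integral>p. f (fst p) * gp (snd p) - f (fst p) * gn (snd p) \<partial>\<gamma>)"
      using hp(2) hn(2) f coupling_L2_integrable(1)[OF \<gamma> f pn(1)] coupling_L2_integrable(1)[OF \<gamma> f pn(2)] by simp
    also have "\<dots> = (\<integral>p. f (fst p) * g (snd p) \<partial>\<gamma>)"
      by (intro Bochner_Integration.integral_cong) (auto simp: gp_def gn_def max_def)
    finally show ?thesis .
  qed
  then show ?thesis using L2_space_diff[OF hp(1) hn(1)] by (intro bexI[of _ "\<lambda>x. hp x - hn x"]) auto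
qed

lemma couplings_swap:
  fixes \<gamma> :: "('a::second_countable_topology \<times> 'b::second_countable_topology) measure"
  assumes "\<gamma> \<in> couplings \<mu> \<nu>" shows "distr \<gamma> borel prod.swap \<in> couplings \<nu> \<mu>"
proof -
  note cf = coupling_facts[OF assms]
  interpret \<gamma>: prob_space \<gamma> by (rule cf)
  have [measurable]: "prod.swap \<in> measurable \<gamma> borel"
    unfolding prod.swap_def using cf(2,3) by measurable
  have [measurable]: "fst \<in> borel_measurable (borel :: ('b \<times> 'a) measure)"
    "snd \<in> borel_measurable (borel :: ('b \<times> 'a) measure)"
    by (auto intro!: borel_measurable_continuous_onI continuous_intros)
  show ?thesis
    unfolding couplings_def borel_prob_def
    by (auto simp: distr_distr comp_def cf(4,5) intro!: \<gamma>.prob_space_distr)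
qed

section \<open>Plan operators and their adjoints\<close>

text \<open>
  The chosen operator has its defining property because one exists: conditional means along the
  reversed coupling.
\<close>

lemma plan_operator_characterization:
  fixes \<gamma> :: "('a::second_countable_topology \<times> 'b::second_countable_topology) measure"
  assumes \<gamma>: "\<gamma> \<in> couplings \<mu> \<nu>" and f: "f \<in> L2_space \<mu>"
  shows "plan_operator \<mu> \<nu> \<gamma> f \<in> L2_space \<nu>"
    and "g \<in> L2_space \<nu> \<Longrightarrow> L2_inner \<nu> (plan_operator \<mu> \<nu> \<gamma> f) g = (\<integral>p. f (fst p) * g (snd p) \<partial>\<gamma>)"
proof -
  note cf = coupling_facts[OF \<gamma>]
  let ?P = "\<lambda>T. \<forall>f\<in>L2_space \<mu>. T f \<in> L2_space \<nu> \<and>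
        (\<forall>g\<in>L2_space \<nu>. L2_inner \<nu> (T f) g = (\<integral>(x, x'). f x * g x' \<partial>\<gamma>))"
  have swap: "prod.swap \<in> measurable \<gamma> borel"
    unfolding prod.swap_def using cf(2,3) by measurable
  have "\<exists>h. h \<in> L2_space \<nu> \<and> (\<forall>g\<in>L2_space \<nu>. L2_inner \<nu> h g = (\<integral>(x, x'). f x * g x' \<partial>\<gamma>))"
    if f: "f \<in> L2_space \<mu>" for f
  proof -
    obtain h where h: "h \<in> L2_space \<nu>" "\<forall>g\<in>L2_space \<nu>. (\<integral>x. g x * h x \<partial>\<nu>)
        = (\<integral>p. g (fst p) * f (snd p) \<partial>distr \<gamma> borel prod.swap)"
      using coupling_conditional[OF couplings_swap[OF \<gamma>] f] by auto
    have "L2_inner \<nu> h g = (\<integral>(x, x'). f x * g x' \<partial>\<gamma>)" if g: "g \<in> L2_space \<nu>" for g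
    proof -
      have "(\<lambda>p. g (fst p) * f (snd p)) \<in> borel_measurable (distr \<gamma> borel prod.swap)"
        by (rule borel_measurable_integrable[OF coupling_L2_integrable(1)[OF couplings_swap[OF \<gamma>] g f]])
      then have "(\<integral>p. g (fst p) * f (snd p) \<partial>distr \<gamma> borel prod.swap) = (\<integral>p. g (snd p) * f (fst p) \<partial>\<gamma>)"
        by (subst integral_distr[OF swap]) auto
      then show ?thesis using h(2) g by (simp add: L2_inner_def case_prod_unfold mult_ac)
    qed
    then show ?thesis using h(1) by blast
  qed
  then have "\<exists>T. ?P T" by (intro bchoice ballI)
  from someI_ex[OF this] have "?P (plan_operator \<mu> \<nu> \<gamma>)" unfolding plan_operator_def .
  with f show "plan_operator \<mu> \<nu> \<gamma> f \<in> L2_space \<nu>"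
    and "g \<in> L2_space \<nu> \<Longrightarrow> L2_inner \<nu> (plan_operator \<mu> \<nu> \<gamma> f) g = (\<integral>p. f (fst p) * g (snd p) \<partial>\<gamma>)"
    by (auto simp: case_prod_unfold)
qed

lemma L2_adjoint_characterization:
  assumes "\<And>g. g \<in> L2_space N \<Longrightarrow>
    \<exists>h\<in>L2_space M. \<forall>f\<in>L2_space M. L2_inner N (T f) g = L2_inner M f h"
  and "g \<in> L2_space N"
  shows "L2_adjoint M N T g \<in> L2_space M"
    and "f \<in> L2_space M \<Longrightarrow> L2_inner N (T f) g = L2_inner M f (L2_adjoint M N T g)"
proof -
  let ?P = "\<lambda>S. \<forall>g\<in>L2_space N. S g \<in> L2_space M \<and> (\<forall>f\<in>L2_space M. L2_inner N (T f) g = L2_inner M f (S g))"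
  have "\<exists>S. ?P S"
    using assms(1) by (intro bchoice) blast
  from someI_ex[OF this] have "?P (L2_adjoint M N T)" unfolding L2_adjoint_def .
  with assms(2) show "L2_adjoint M N T g \<in> L2_space M"
    and "f \<in> L2_space M \<Longrightarrow> L2_inner N (T f) g = L2_inner M f (L2_adjoint M N T g)" by auto
qed

text \<open>
  Any two representatives of an adjoint agree almost everywhere: their difference is orthogonal to
  itself.
\<close>

lemma L2_adjoint_unique:
  assumes h: "h \<in> L2_space M" "\<And>f. f \<in> L2_space M \<Longrightarrow> L2_inner M f h = L2_inner M f h'"
    and h': "h' \<in> L2_space M"
  shows "AE x in M. h x = h' x"
proof -
  let ?d = "\<lambda>x. h x - h' x"
  have d: "?d \<in> L2_space M" by (rule L2_space_diff[OF h(1) h'])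
  have "(\<integral>x. ?d x * h x \<partial>M) - (\<integral>x. ?d x * h' x \<partial>M) = (\<integral>x. ?d x * h x - ?d x * h' x \<partial>M)"
    by (intro Bochner_Integration.integral_diff[symmetric] L2_mult_integrable L2_spaceD d h h')
  then have "(\<integral>x. (?d x)\<^sup>2 \<partial>M) = 0"
    using h(2)[OF d] by (simp add: L2_inner_def power2_eq_square right_diff_distrib)
  then have "AE x in M. (?d x)\<^sup>2 = 0"
    using L2_spaceD(2)[OF d] by (subst (asm) integral_nonneg_eq_0_iff_AE) auto
  then show ?thesis by simp
qed

lemma plan_adjoint_characterization:
  fixes \<gamma> :: "('a::second_countable_topology \<times> 'b::second_countable_topology) measure"
  assumes \<gamma>: "\<gamma> \<in> couplings \<mu> \<nu>" and g: "g \<in> L2_space \<nu>"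
  shows "L2_adjoint \<mu> \<nu> (plan_operator \<mu> \<nu> \<gamma>) g \<in> L2_space \<mu>"
    and "f \<in> L2_space \<mu> \<Longrightarrow>
      L2_inner \<mu> f (L2_adjoint \<mu> \<nu> (plan_operator \<mu> \<nu> \<gamma>) g) = (\<integral>p. f (fst p) * g (snd p) \<partial>\<gamma>)"
proof -
  have ex: "\<exists>h\<in>L2_space \<mu>. \<forall>f\<in>L2_space \<mu>. L2_inner \<nu> (plan_operator \<mu> \<nu> \<gamma> f) g = L2_inner \<mu> f h"
    if g: "g \<in> L2_space \<nu>" for g
  proof -
    obtain h where "h \<in> L2_space \<mu>"
      "\<forall>f\<in>L2_space \<mu>. (\<integral>x. f x * h x \<partial>\<mu>) = (\<integral>p. f (fst p) * g (snd p) \<partial>\<gamma>)"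
      using coupling_conditional[OF \<gamma> g] by blast
    then show ?thesis
      using plan_operator_characterization(2)[OF \<gamma> _ g] by (intro bexI[of _ h]) (auto simp: L2_inner_def)
  qed
  show "L2_adjoint \<mu> \<nu> (plan_operator \<mu> \<nu> \<gamma>) g \<in> L2_space \<mu>"
    by (rule L2_adjoint_characterization(1)[OF ex g])
  show "L2_inner \<mu> f (L2_adjoint \<mu> \<nu> (plan_operator \<mu> \<nu> \<gamma>) g) = (\<integral>p. f (fst p) * g (snd p) \<partial>\<gamma>)"
    if "f \<in> L2_space \<mu>"
    using L2_adjoint_characterization(2)[OF ex g that] plan_operator_characterization(2)[OF \<gamma> that g] by simp
qed

text \<open>
  Let \<open>d\<close> be the difference of \<open>w\<close> and the adjoint image of \<open>v\<close>. Testing the defining relation of the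
  adjoint with \<open>d\<close> itself gives \<open>\<integral> d\<^sup>2 \<partial>\<mu> = \<integral> d (fst p) * (w (fst p) - v (snd p)) \<partial>\<gamma>\<close>. Here \<open>v\<close> may
  be replaced by \<open>w\<close>, and Young's inequality absorbs half of the left-hand side. This is the
  inequality of Jensen for the conditional mean.
\<close>

lemma plan_adjoint_distance:
  fixes \<gamma> :: "('a::{second_countable_topology,metric_space} \<times> 'a) measure" and w :: "'a \<Rightarrow> real"
  assumes \<gamma>: "\<gamma> \<in> couplings \<mu> \<nu>" and v: "v \<in> L2_space \<nu>" and w: "w \<in> L2_space \<mu>"
    and ae: "AE y in \<nu>. v y = w y"
    and lip: "\<And>y y'. \<bar>w y - w y'\<bar> \<le> K * dist y y'"
    and int: "integrable \<gamma> (\<lambda>p. (dist (fst p) (snd p))\<^sup>2)" and K: "K \<ge> 0"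
  shows "L2_norm \<mu> (\<lambda>y. w y - L2_adjoint \<mu> \<nu> (plan_operator \<mu> \<nu> \<gamma>) v y) \<le> K * sqrt (sq_cost \<gamma>)"
proof -
  note cf = coupling_facts[OF \<gamma>]
  define S where "S = L2_adjoint \<mu> \<nu> (plan_operator \<mu> \<nu> \<gamma>) v"
  define d where "d y = w y - S y" for y
  have S: "S \<in> L2_space \<mu>" unfolding S_def by (rule plan_adjoint_characterization(1)[OF \<gamma> v])
  have d: "d \<in> L2_space \<mu>" unfolding d_def by (rule L2_space_diff[OF w S])
  have [measurable]: "w \<in> borel_measurable borel" "d \<in> borel_measurable borel"
    using L2_spaceD(1)[OF w] L2_spaceD(1)[OF d] measurable_cong_sets[OF cf(6) refl] by auto
  note [measurable] = cf(2,3)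
  note dv = coupling_L2_integrable[OF \<gamma> d v]
  note wv = coupling_L2_integrable[OF \<gamma> w v]
  have dw: "integrable \<gamma> (\<lambda>p. d (fst p) * w (fst p))"
    "(\<integral>p. d (fst p) * w (fst p) \<partial>\<gamma>) = (\<integral>y. d y * w y \<partial>\<mu>)"
    using L2_mult_integrable[OF L2_spaceD(1)[OF d] L2_spaceD(1)[OF w] L2_spaceD(2)[OF d] L2_spaceD(2)[OF w]]
      integrable_distr_eq[OF cf(2), of "\<lambda>y. d y * w y"] integral_distr[OF cf(2), of "\<lambda>y. d y * w y"] cf(4)
    by simp_all
  have d2: "(\<integral>p. (d (fst p))\<^sup>2 \<partial>\<gamma>) = (\<integral>y. (d y)\<^sup>2 \<partial>\<mu>)"
    using integral_distr[OF cf(2), of "\<lambda>y. (d y)\<^sup>2"] cf(4) by simp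
  have "AE p in \<gamma>. v (snd p) = w (snd p)"
    using ae unfolding cf(5)[symmetric] by (rule AE_distrD[OF cf(3)])
  then have bound: "AE p in \<gamma>. d (fst p) * (w (fst p) - v (snd p)) \<le> ((d (fst p))\<^sup>2 + K\<^sup>2 * (dist (fst p) (snd p))\<^sup>2) / 2"
  proof eventually_elim
    case (elim p)
    have "2 * (d (fst p) * (w (fst p) - w (snd p))) \<le> (d (fst p))\<^sup>2 + (w (fst p) - w (snd p))\<^sup>2"
      using sum_squares_bound[of "d (fst p)" "w (fst p) - w (snd p)"] by simp
    also have "(w (fst p) - w (snd p))\<^sup>2 \<le> (K * dist (fst p) (snd p))\<^sup>2"
      using lip[of "fst p" "snd p"] by (intro abs_le_square_iff[THEN iffD1]) auto
    finally show ?case by (simp add: elim power_mult_distrib)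
  qed
  have "(\<integral>y. (d y)\<^sup>2 \<partial>\<mu>) = (\<integral>y. d y * w y - d y * S y \<partial>\<mu>)"
    by (simp add: d_def power2_eq_square right_diff_distrib)
  also have "\<dots> = (\<integral>y. d y * w y \<partial>\<mu>) - L2_inner \<mu> d S"
    unfolding L2_inner_def by (intro Bochner_Integration.integral_diff L2_mult_integrable L2_spaceD d w S)
  also have "\<dots> = (\<integral>p. d (fst p) * w (fst p) \<partial>\<gamma>) - (\<integral>p. d (fst p) * v (snd p) \<partial>\<gamma>)"
    using plan_adjoint_characterization(2)[OF \<gamma> v d] dw(2) by (simp add: S_def)
  also have "\<dots> = (\<integral>p. d (fst p) * (w (fst p) - v (snd p)) \<partial>\<gamma>)"
    unfolding right_diff_distrib by (rule Bochner_Integration.integral_diff[symmetric, OF dw(1) dv(1)])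
  also have "\<dots> \<le> (\<integral>p. ((d (fst p))\<^sup>2 + K\<^sup>2 * (dist (fst p) (snd p))\<^sup>2) / 2 \<partial>\<gamma>)"
    using dw(1) dv(1,2) int bound by (intro integral_mono_AE) (auto simp: right_diff_distrib)
  also have "\<dots> = ((\<integral>y. (d y)\<^sup>2 \<partial>\<mu>) + K\<^sup>2 * sq_cost \<gamma>) / 2"
    using dv(2) int d2 by (simp add: sq_cost_def)
  finally have "(\<integral>y. (d y)\<^sup>2 \<partial>\<mu>) \<le> K\<^sup>2 * sq_cost \<gamma>" by simp
  then have "sqrt (\<integral>y. (d y)\<^sup>2 \<partial>\<mu>) \<le> sqrt (K\<^sup>2 * sq_cost \<gamma>)" by simp
  also have "\<dots> = K * sqrt (sq_cost \<gamma>)" using K by (simp add: real_sqrt_mult)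
  finally show ?thesis by (simp add: L2_norm_def d_def S_def)
qed

text \<open>
  The plan and the distance refer to the two measures in opposite orders, so competitors are
  reversed before they are compared.
\<close>

lemma optimal_plan_le_W2:
  fixes \<mu> \<nu> :: "'a::{second_countable_topology,metric_space} measure"
  assumes "optimal_plan \<mu> \<nu> \<gamma>"
  shows "sqrt (sq_cost \<gamma>) \<le> W2 \<nu> \<mu>"
proof -
  have \<gamma>: "\<gamma> \<in> couplings \<mu> \<nu>" and opt: "\<And>\<gamma>'. \<gamma>' \<in> couplings \<mu> \<nu> \<Longrightarrow> sq_cost \<gamma> \<le> sq_cost \<gamma>'"
    using assms by (auto simp: optimal_plan_def)
  have "sq_cost \<gamma> \<le> sq_cost \<gamma>'" if \<gamma>': "\<gamma>' \<in> couplings \<nu> \<mu>" for \<gamma>'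
  proof -
    note cf = coupling_facts[OF \<gamma>']
    have swap: "prod.swap \<in> measurable \<gamma>' borel"
      unfolding prod.swap_def using cf(2,3) by measurable
    have "(\<lambda>p::'a \<times> 'a. (dist (fst p) (snd p))\<^sup>2) \<in> borel_measurable borel"
      by (intro borel_measurable_continuous_onI continuous_intros)
    then have "sq_cost (distr \<gamma>' borel prod.swap) = sq_cost \<gamma>'"
      unfolding sq_cost_def by (subst integral_distr[OF swap]) (auto simp: dist_commute)
    then show ?thesis using opt[OF couplings_swap[OF \<gamma>']] by simp
  qed
  then have "sq_cost \<gamma> \<le> (INF \<gamma>'\<in>couplings \<nu> \<mu>. sq_cost \<gamma>')"
    using couplings_swap[OF \<gamma>] by (intro cINF_greatest) auto
  then show ?thesis unfolding W2_def by simp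
qed

section \<open>Ball masses of an i.i.d. sample\<close>

text \<open>
  The complement of the support is covered by the null sets of a countable basis.
\<close>

lemma AE_in_spt:
  fixes \<mu> :: "'a::second_countable_topology measure"
  assumes "sets \<mu> = sets borel"
  shows "AE x in \<mu>. x \<in> spt \<mu>"
proof -
  obtain B :: "'a set set" where B: "countable B" "topological_basis B"
    using ex_countable_basis by blast
  define Z where "Z = {U \<in> B. emeasure \<mu> U = 0}"
  have "\<Union>Z \<in> null_sets \<mu>"
    using B(1) topological_basis_open[OF B(2)] assms
    by (intro null_sets_UN'[of Z "\<lambda>U. U", simplified]) (auto simp: Z_def null_sets_def)
  moreover have "- spt \<mu> \<subseteq> \<Union>Z"
  proof
    fix x assume "x \<in> - spt \<mu>"
    then obtain U where U: "open U" "x \<in> U" "emeasure \<mu> U = 0"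
      by (auto simp: spt_def zero_less_iff_neq_zero)
    then obtain V where V: "V \<in> B" "x \<in> V" "V \<subseteq> U"
      using topological_basisE[OF B(2)] by metis
    then have "emeasure \<mu> V = 0"
      using U emeasure_mono[of V U \<mu>] assms by simp
    with V show "x \<in> \<Union>Z" by (auto simp: Z_def)
  qed
  ultimately show ?thesis
    by (intro AE_I'[of "\<Union>Z"]) auto
qed

lemma indep_vars_PiM_components:
  assumes \<nu>: "prob_space \<nu>" and J: "finite J" "J \<noteq> {}"
  shows "prob_space.indep_vars (Pi\<^sub>M J (\<lambda>_. \<nu>)) (\<lambda>_. \<nu>) (\<lambda>j w. w j) J"
proof -
  interpret P: prob_space "Pi\<^sub>M J (\<lambda>_. \<nu>)" using \<nu> by (intro prob_space_PiM)
  have "distr (Pi\<^sub>M J (\<lambda>_. \<nu>)) (Pi\<^sub>M J (\<lambda>_. \<nu>)) (\<lambda>w. \<lambda>j\<in>J. w j)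
      = distr (Pi\<^sub>M J (\<lambda>_. \<nu>)) (Pi\<^sub>M J (\<lambda>_. \<nu>)) (\<lambda>w. w)"
    by (intro distr_cong) (auto simp: space_PiM PiE_restrict)
  also have "\<dots> = Pi\<^sub>M J (\<lambda>_. \<nu>)" by (rule distr_id)
  also have "\<dots> = Pi\<^sub>M J (\<lambda>j. distr (Pi\<^sub>M J (\<lambda>_. \<nu>)) \<nu> (\<lambda>w. w j))"
    using J \<nu> by (intro PiM_cong refl distr_PiM_component[symmetric])
  finally show ?thesis
    using J by (subst P.indep_vars_iff_distr_eq_PiM') auto
qed

text \<open>
  Hoeffding's inequality for the number of independent points that fall into a fixed set.
\<close>

lemma hits_lower_tail:
  assumes \<nu>: "prob_space \<nu>" and J: "finite J" "J \<noteq> {}" and A: "A \<in> sets \<nu>" and t: "t \<ge> 0"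
  shows "measure (Pi\<^sub>M J (\<lambda>_. \<nu>))
      {w \<in> space (Pi\<^sub>M J (\<lambda>_. \<nu>)). (\<Sum>j\<in>J. indicator A (w j)) \<le> card J * measure \<nu> A - t}
    \<le> exp (- 2 * t\<^sup>2 / card J)"
proof -
  interpret \<nu>: prob_space \<nu> by (rule \<nu>)
  interpret P: prob_space "Pi\<^sub>M J (\<lambda>_. \<nu>)" using \<nu> by (intro prob_space_PiM)
  note [measurable] = A
  have indep: "P.indep_vars (\<lambda>_. borel) (\<lambda>j w. indicator A (w j) :: real) J"
    using P.indep_vars_compose2[OF indep_vars_PiM_components[OF \<nu> J], of "\<lambda>_. indicator A :: _ \<Rightarrow> real"]
    by simp
  have E: "(\<integral>w. indicator A (w j) \<partial>Pi\<^sub>M J (\<lambda>_. \<nu>)) = measure \<nu> A" if "j \<in> J" for j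
  proof -
    have "(\<integral>w. indicator A (w j) \<partial>Pi\<^sub>M J (\<lambda>_. \<nu>)) = (\<integral>y. (indicator A y :: real) \<partial>distr (Pi\<^sub>M J (\<lambda>_. \<nu>)) \<nu> (\<lambda>w. w j))"
      using that by (intro integral_distr[symmetric]) auto
    also have "distr (Pi\<^sub>M J (\<lambda>_. \<nu>)) \<nu> (\<lambda>w. w j) = \<nu>"
      using J \<nu> that by (intro distr_PiM_component)
    finally show ?thesis using A by simp
  qed
  interpret H: Hoeffding_ineq "Pi\<^sub>M J (\<lambda>_. \<nu>)" J "\<lambda>j w. indicator A (w j)" "\<lambda>_. 0" "\<lambda>_. 1" "card J * measure \<nu> A"
    by unfold_locales (use J indep E in \<open>auto simp: indicator_def\<close>)
  have "card J > 0" using J by (simp add: card_gt_0_iff)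
  then show ?thesis using H.Hoeffding_ineq_le[OF t] by simp
qed

text \<open>
  With the centre \<open>w i = y\<close> frozen, the other \<open>N - 1\<close> points are independent of it and
  \<open>hits_lower_tail\<close> applies. The centre always hits its own ball, which makes up for the missing
  point: the bound has the exponent of \<open>N\<close> independent points.
\<close>

lemma self_hits_lower_tail:
  fixes \<nu> :: "'a::{metric_space,second_countable_topology} measure" and i N :: nat and p r :: real
  assumes \<nu>: "borel_prob \<nu>" and N: "i < N" and r: "r > 0" and p: "0 \<le> p"
    and ball: "AE y in \<nu>. p \<le> measure \<nu> (ball y r)"
  shows "emeasure (Pi\<^sub>M {..<N} (\<lambda>_. \<nu>))
      {w \<in> space (Pi\<^sub>M {..<N} (\<lambda>_. \<nu>)). (\<Sum>j<N. of_bool (dist (w i) (w j) < r)) < N * p / 2}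
    \<le> ennreal (exp (- (N / 2) * p\<^sup>2))"
proof -
  define J where "J = {..<N} - {i}"
  have J: "finite J" "i \<notin> J" "insert i J = {..<N}" "card J = N - 1" using N by (auto simp: J_def)
  interpret \<nu>: prob_space \<nu> using \<nu> by (simp add: borel_prob_def)
  have sets [measurable_cong]: "sets \<nu> = sets borel" using \<nu> by (simp add: borel_prob_def)
  interpret prod: product_sigma_finite "\<lambda>_::nat. \<nu>" by unfold_locales
  interpret P: prob_space "Pi\<^sub>M J (\<lambda>_. \<nu>)" using \<nu>.prob_space_axioms by (intro prob_space_PiM)
  let ?B = "{w \<in> space (Pi\<^sub>M {..<N} (\<lambda>_. \<nu>)). (\<Sum>j<N. of_bool (dist (w i) (w j) < r)) < N * p / 2}"
  have B [measurable]: "?B \<in> sets (Pi\<^sub>M {..<N} (\<lambda>_. \<nu>))"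
  proof -
    have "i \<in> {..<N}" using N by simp
    then show ?thesis by measurable
  qed
  have tail: "(\<integral>\<^sup>+x. indicator ?B (x(i := y)) \<partial>Pi\<^sub>M J (\<lambda>_. \<nu>)) \<le> ennreal (exp (- (N / 2) * p\<^sup>2))"
    if y: "p \<le> measure \<nu> (ball y r)" for y
  proof -
    have p1: "p \<le> 1" using y \<nu>.prob_le_1 order_trans by blast
    \<comment> \<open>The \<open>- 1\<close> is the hit of the centre itself.\<close>
    let ?C = "{w \<in> space (Pi\<^sub>M J (\<lambda>_. \<nu>)). (\<Sum>j\<in>J. indicator (ball y r) (w j)) \<le> N * p / 2 - 1}"
    have [measurable]: "ball y r \<in> sets borel" by simp
    have C: "?C \<in> sets (Pi\<^sub>M J (\<lambda>_. \<nu>))" by measurable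
    have "(\<integral>\<^sup>+x. indicator ?B (x(i := y)) \<partial>Pi\<^sub>M J (\<lambda>_. \<nu>)) \<le> (\<integral>\<^sup>+x. indicator ?C x \<partial>Pi\<^sub>M J (\<lambda>_. \<nu>))"
    proof (rule nn_integral_mono)
      fix x assume x: "x \<in> space (Pi\<^sub>M J (\<lambda>_. \<nu>))"
      have "(\<Sum>j<N. of_bool (dist ((x(i := y)) i) ((x(i := y)) j) < r)) = 1 + (\<Sum>j\<in>J. indicator (ball y r) (x j) :: real)"
      proof -
        have "(\<Sum>j\<in>J. of_bool (dist y ((x(i := y)) j) < r)) = (\<Sum>j\<in>J. indicator (ball y r) (x j) :: real)"
          using J(2) by (intro sum.cong) (auto simp: indicator_def)
        then show ?thesis unfolding J(3)[symmetric] using J(1,2) r by (simp del: sum_of_bool_eq)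
      qed
      then show "indicator ?B (x(i := y)) \<le> (indicator ?C x :: ennreal)"
        using x by (auto simp: indicator_def)
    qed
    also have "\<dots> = ennreal (measure (Pi\<^sub>M J (\<lambda>_. \<nu>)) ?C)"
      using C by (simp add: P.emeasure_eq_measure)
    also have "measure (Pi\<^sub>M J (\<lambda>_. \<nu>)) ?C \<le> exp (- (N / 2) * p\<^sup>2)"
    proof (cases "J = {}")
      case True
      then have "N = 1" using J(4) N by auto
      then have empty: "?C = {}" using p1 True by auto
      show ?thesis unfolding empty by simp
    next
      case False
      then have "card J > 0" using J(1) by (simp add: card_gt_0_iff)
      moreover have "real (card J) = real N - 1" using J(4) N by (simp add: of_nat_diff)
      ultimately have n: "card J > 0" "real (card J) = real N - 1" by blast+
      \<comment> \<open>The deviation \<open>t\<close> of the threshold from the mean is at least \<open>N * p / 2\<close>, because \<open>p \<le> 1\<close>.\<close>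
      define t where "t = card J * measure \<nu> (ball y r) - (N * p / 2 - 1)"
      have "real N * p / 2 \<le> (real N - 1) * p - (N * p / 2 - 1)" using p1 by (simp add: algebra_simps)
      also have "\<dots> \<le> t" unfolding t_def n(2) using y n by (intro diff_right_mono mult_left_mono) auto
      finally have t: "real N * p / 2 \<le> t" .
      have "0 \<le> real N * p / 2" using p by simp
      with t have t0: "0 \<le> t" by linarith
      have "measure (Pi\<^sub>M J (\<lambda>_. \<nu>)) ?C \<le> exp (- 2 * t\<^sup>2 / card J)"
        using hits_lower_tail[OF \<nu>.prob_space_axioms J(1) False, of "ball y r" t] t0 sets
        by (simp add: t_def)
      also have "\<dots> \<le> exp (- (N / 2) * p\<^sup>2)"
      proof -
        have "N * p\<^sup>2 / 2 * card J \<le> N * p\<^sup>2 / 2 * N" using n by (intro mult_left_mono) auto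
        also have "\<dots> = 2 * (N * p / 2)\<^sup>2" by (simp add: power2_eq_square)
        also have "\<dots> \<le> 2 * t\<^sup>2" using t p by (intro mult_left_mono power_mono) auto
        finally have "N * p\<^sup>2 / 2 \<le> 2 * t\<^sup>2 / card J" using n by (simp add: pos_le_divide_eq)
        then show ?thesis by simp
      qed
      finally show ?thesis .
    qed
    finally show ?thesis by (simp add: ennreal_leI)
  qed
  have "emeasure (Pi\<^sub>M {..<N} (\<lambda>_. \<nu>)) ?B = (\<integral>\<^sup>+w. indicator ?B w \<partial>Pi\<^sub>M {..<N} (\<lambda>_. \<nu>))"
    by (rule nn_integral_indicator[OF B, symmetric])
  also have "\<dots> = (\<integral>\<^sup>+y. \<integral>\<^sup>+x. indicator ?B (x(i := y)) \<partial>Pi\<^sub>M J (\<lambda>_. \<nu>) \<partial>\<nu>)"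
    using prod.product_nn_integral_insert_rev[OF J(1,2), unfolded J(3), OF borel_measurable_indicator[OF B]] .
  also have "\<dots> \<le> (\<integral>\<^sup>+y. ennreal (exp (- (N / 2) * p\<^sup>2)) \<partial>\<nu>)"
    by (rule nn_integral_mono_AE, use ball in eventually_elim) (rule tail)
  also have "\<dots> = ennreal (exp (- (N / 2) * p\<^sup>2))" by (simp add: \<nu>.emeasure_space_1)
  finally show ?thesis .
qed

text \<open>
  The law of the sample is a product measure, so \<open>self_hits_lower_tail\<close> bounds the probability that
  one of the points has too few neighbours, and the union bound handles all of them.
\<close>

lemma iid_ball_mass_event:
  fixes \<nu> :: "'a::{metric_space,second_countable_topology} measure" and N :: nat and p r :: real
    and Y :: "nat \<Rightarrow> 'w \<Rightarrow> 'a"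
  defines "hits \<equiv> \<lambda>N r Y \<omega> i. (\<Sum>j<N. of_bool (dist (Y i \<omega>) (Y j \<omega>) < r)) :: real"
  assumes P: "prob_space P" and indep: "prob_space.indep_vars P (\<lambda>_. borel) Y {..<N}"
    and law: "\<And>i. i < N \<Longrightarrow> distr P borel (Y i) = \<nu>" and N: "N \<ge> 1"
    and \<nu>: "borel_prob \<nu>" and r: "r > 0" and p: "0 \<le> p"
    and ball: "AE y in \<nu>. p \<le> measure \<nu> (ball y r)"
  shows "\<exists>A\<in>sets P. 1 - N * exp (- (N / 2) * p\<^sup>2) \<le> measure P A \<and>
    (\<forall>\<omega>\<in>A. \<forall>i<N. N * p / 2 \<le> hits N r Y \<omega> i)"
proof -
  interpret P: prob_space P by (rule P)
  have [measurable]: "i < N \<Longrightarrow> Y i \<in> borel_measurable P" for i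
    using indep by (auto simp: P.indep_vars_def)
  have sets: "sets \<nu> = sets borel" using \<nu> by (simp add: borel_prob_def)
  define bad where "bad i = {\<omega> \<in> space P. hits N r Y \<omega> i < N * p / 2}" for i
  have bad_sets: "bad i \<in> sets P" if "i < N" for i
    unfolding bad_def hits_def using that by measurable
  have bad: "measure P (bad i) \<le> exp (- (N / 2) * p\<^sup>2)" if i: "i < N" for i
  proof -
    let ?B = "{w \<in> space (Pi\<^sub>M {..<N} (\<lambda>_. \<nu>)). (\<Sum>j<N. of_bool (dist (w i) (w j) < r)) < N * p / 2}"
    let ?Y = "\<lambda>\<omega>. \<lambda>j\<in>{..<N}. Y j \<omega>"
    have "{..<N} \<noteq> {}" using N by (auto simp: lessThan_empty_iff)
    then have "distr P (Pi\<^sub>M {..<N} (\<lambda>_. borel)) ?Y = Pi\<^sub>M {..<N} (\<lambda>j. distr P borel (Y j))"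
      using indep by (subst (asm) P.indep_vars_iff_distr_eq_PiM') auto
    also have "\<dots> = Pi\<^sub>M {..<N} (\<lambda>_. \<nu>)" using law by (intro PiM_cong) auto
    finally have D: "distr P (Pi\<^sub>M {..<N} (\<lambda>_. borel)) ?Y = Pi\<^sub>M {..<N} (\<lambda>_. \<nu>)" .
    have setsP: "sets (Pi\<^sub>M {..<N} (\<lambda>_. \<nu>)) = sets (Pi\<^sub>M {..<N} (\<lambda>_. borel :: 'a measure))"
      using sets by (intro sets_PiM_cong) auto
    have spaceP: "space (Pi\<^sub>M {..<N} (\<lambda>_. \<nu>)) = space (Pi\<^sub>M {..<N} (\<lambda>_. borel :: 'a measure))"
      by (rule sets_eq_imp_space_eq[OF setsP])
    have B: "?B \<in> sets (Pi\<^sub>M {..<N} (\<lambda>_. borel))"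
    proof -
      have "i \<in> {..<N}" using i by simp
      then show ?thesis unfolding spaceP by measurable
    qed
    have "?Y \<in> measurable P (Pi\<^sub>M {..<N} (\<lambda>_. borel))" by (intro measurable_restrict) auto
    from emeasure_distr[OF this B]
    have "emeasure (Pi\<^sub>M {..<N} (\<lambda>_. \<nu>)) ?B = emeasure P (?Y -` ?B \<inter> space P)"
      by (simp only: D)
    also have "?Y -` ?B \<inter> space P = bad i"
    proof -
      have "(\<Sum>j<N. of_bool (dist (?Y \<omega> i) (?Y \<omega> j) < r)) = hits N r Y \<omega> i" for \<omega>
        unfolding hits_def using i by (intro sum.cong) auto
      moreover have "?Y \<omega> \<in> space (Pi\<^sub>M {..<N} (\<lambda>_. \<nu>))" for \<omega>
        unfolding spaceP by (simp add: space_PiM)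
      ultimately show ?thesis by (auto simp: bad_def simp del: sum_of_bool_eq)
    qed
    finally have "emeasure P (bad i) \<le> ennreal (exp (- (N / 2) * p\<^sup>2))"
      using self_hits_lower_tail[OF \<nu> i r p ball] by simp
    then show ?thesis by (simp add: P.emeasure_eq_measure)
  qed
  have "measure P (\<Union>i<N. bad i) \<le> (\<Sum>i<N. measure P (bad i))"
    using bad_sets by (intro P.finite_measure_subadditive_finite) auto
  also have "\<dots> \<le> (\<Sum>i<N. exp (- (N / 2) * p\<^sup>2))" using bad by (intro sum_mono) auto
  finally have union: "measure P (\<Union>i<N. bad i) \<le> N * exp (- (N / 2) * p\<^sup>2)" by simp
  have "(\<Union>i<N. bad i) \<in> sets P" using bad_sets by auto
  then show ?thesis
    using union
    by (intro bexI[of _ "space P - (\<Union>i<N. bad i)"]) (auto simp: P.prob_compl bad_def)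
qed

section \<open>Extensions of singular functions\<close>

lemma L2_space_continuous:
  fixes f :: "'a::topological_space \<Rightarrow> real"
  assumes X: "compact (UNIV :: 'a set)" and \<mu>: "borel_prob \<mu>" and f: "continuous_on UNIV f"
  shows "f \<in> L2_space \<mu>"
  unfolding L2_space_def
  using borel_prob_integrable[OF X \<mu> f] borel_prob_integrable[OF X \<mu> continuous_on_power[OF f, of 2]]
  by auto

text \<open>
  The variance of \<open>\<bar>u\<bar>\<close> is nonnegative.
\<close>

lemma integral_abs_le_L2_norm:
  assumes "prob_space M" and u: "u \<in> L2_space M"
  shows "integrable M u" and "(\<integral>x. \<bar>u x\<bar> \<partial>M) \<le> L2_norm M u"
proof -
  interpret prob_space M by fact
  note L = L2_spaceD[OF u]
  show int: "integrable M u" using L2_mult_integrable[of u M "\<lambda>_. 1"] L by simp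
  have "0 \<le> variance (\<lambda>x. \<bar>u x\<bar>)" by (rule variance_positive)
  also have "\<dots> = (\<integral>x. (u x)\<^sup>2 \<partial>M) - (\<integral>x. \<bar>u x\<bar> \<partial>M)\<^sup>2"
    using int L(2) by (subst variance_eq) auto
  finally show "(\<integral>x. \<bar>u x\<bar> \<partial>M) \<le> L2_norm M u"
    unfolding L2_norm_def by (intro real_le_rsqrt) simp
qed

text \<open>
  Integration against \<open>u\<close> keeps the Lipschitz bound of the kernel up to the factor
  \<open>\<integral> \<bar>u\<bar> \<partial>\<rho>\<close>, which is at most the norm of \<open>u\<close>; the distance estimate for the plan then applies to the
  extension. Keeping \<open>\<tau>\<close>, \<open>\<rho>\<close> and the marginals arbitrary lets the two halves of the theorem share
  this argument.
\<close>

lemma singular_extension_distance: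
  fixes \<tau> :: "'a::{metric_space,second_countable_topology} \<Rightarrow> 'a \<Rightarrow> real"
  assumes X: "compact (UNIV :: 'a set)" and \<rho>: "borel_prob \<rho>" and \<nu>: "borel_prob \<nu>"
    and opt: "optimal_plan \<nu> \<nu>' \<gamma>"
    and \<tau>: "\<And>y. continuous_on UNIV (\<lambda>x. \<tau> x y)" and lip: "\<And>x y y'. \<bar>\<tau> x y - \<tau> x y'\<bar> \<le> K * dist y y'"
    and K: "0 \<le> K" and s: "0 < s" and u: "u \<in> L2_space \<rho>" and v: "v \<in> L2_space \<nu>'"
    and ae: "AE y in \<nu>'. v y = (1 / s) * L2_inner \<rho> (\<lambda>x. \<tau> x y) u"
  shows "L2_norm \<nu> (\<lambda>y. (1 / s) * L2_inner \<rho> (\<lambda>x. \<tau> x y) u - L2_adjoint \<nu> \<nu>' (plan_operator \<nu> \<nu>' \<gamma>) v y)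
      \<le> K * (1 / s) * L2_norm \<rho> u * W2 \<nu>' \<nu>"
proof -
  interpret \<rho>: prob_space \<rho> using \<rho> by (simp add: borel_prob_def)
  have \<gamma>: "\<gamma> \<in> couplings \<nu> \<nu>'" using opt by (simp add: optimal_plan_def)
  define w where "w y = (1 / s) * L2_inner \<rho> (\<lambda>x. \<tau> x y) u" for y
  define K' where "K' = K * (1 / s) * L2_norm \<rho> u"
  have norm0: "0 \<le> L2_norm \<rho> u" by (simp add: L2_norm_def)
  then have K': "0 \<le> K'" using K s by (simp add: K'_def)
  note u1 = integral_abs_le_L2_norm[OF \<rho>.prob_space_axioms u]
  have int: "integrable \<rho> (\<lambda>x. \<tau> x y * u x)" for y
    using L2_mult_integrable L2_spaceD[OF u] L2_spaceD[OF L2_space_continuous[OF X \<rho> \<tau>]] by blast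
  have lip_w: "\<bar>w y - w y'\<bar> \<le> K' * dist y y'" for y y'
  proof -
    have "\<bar>L2_inner \<rho> (\<lambda>x. \<tau> x y) u - L2_inner \<rho> (\<lambda>x. \<tau> x y') u\<bar>
        = \<bar>\<integral>x. \<tau> x y * u x - \<tau> x y' * u x \<partial>\<rho>\<bar>"
      using int by (simp add: L2_inner_def)
    also have "\<dots> \<le> (\<integral>x. \<bar>\<tau> x y * u x - \<tau> x y' * u x\<bar> \<partial>\<rho>)" by (rule integral_abs_bound)
    also have "\<dots> \<le> (\<integral>x. (K * dist y y') * \<bar>u x\<bar> \<partial>\<rho>)"
    proof (intro integral_mono integrable_abs Bochner_Integration.integrable_diff int integrable_mult_right u1(1))
      show "\<bar>\<tau> x y * u x - \<tau> x y' * u x\<bar> \<le> (K * dist y y') * \<bar>u x\<bar>" for x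
        using lip[of x y y'] by (simp add: abs_mult mult_right_mono flip: left_diff_distrib)
    qed
    also have "\<dots> = K * dist y y' * (\<integral>x. \<bar>u x\<bar> \<partial>\<rho>)" by simp
    also have "\<dots> \<le> K * dist y y' * L2_norm \<rho> u" using u1(2) K by (intro mult_left_mono) auto
    finally have "(1 / s) * \<bar>L2_inner \<rho> (\<lambda>x. \<tau> x y) u - L2_inner \<rho> (\<lambda>x. \<tau> x y') u\<bar>
        \<le> (1 / s) * (K * dist y y' * L2_norm \<rho> u)" using s by (intro mult_left_mono) auto
    then show ?thesis
      using s by (simp add: w_def K'_def right_diff_distrib[symmetric] abs_mult mult_ac flip: diff_divide_distrib)
  qed
  have "K'-lipschitz_on UNIV w"
    using lip_w K' by (intro lipschitz_onI) (auto simp: dist_real_def)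
  then have w: "w \<in> L2_space \<nu>" by (intro L2_space_continuous X \<nu> lipschitz_on_continuous_on)
  have "compact (UNIV :: ('a \<times> 'a) set)" using compact_Times[OF X X] by simp
  then have "integrable \<gamma> (\<lambda>p. (dist (fst p) (snd p))\<^sup>2)"
    using \<gamma> by (intro borel_prob_integrable) (auto simp: couplings_def intro!: continuous_intros)
  from plan_adjoint_distance[OF \<gamma> v w _ lip_w this K']
  have "L2_norm \<nu> (\<lambda>y. w y - L2_adjoint \<nu> \<nu>' (plan_operator \<nu> \<nu>' \<gamma>) v y) \<le> K' * sqrt (sq_cost \<gamma>)"
    using ae by (simp add: w_def)
  also have "\<dots> \<le> K' * W2 \<nu>' \<nu>" using optimal_plan_le_W2[OF opt] K' by (intro mult_left_mono)
  finally show ?thesis by (simp add: w_def K'_def)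
qed

lemma L2_space_empirical:
  assumes "f \<in> borel_measurable borel" shows "f \<in> L2_space (empirical N z)"
  using assms integrable_empirical[of "\<lambda>x. (f x)\<^sup>2" N z]
  by (simp add: L2_space_def empirical_def)

text \<open>
  Interchanging the two finite sums identifies the adjoint of an integral operator as the one with
  the transposed kernel. This rewrites the singular relation for \<open>u\<close> into the form of the one for \<open>v\<close>.
\<close>

lemma kernel_operator_adjoint_empirical:
  fixes t :: "'a::topological_space \<Rightarrow> 'b::topological_space \<Rightarrow> real"
  assumes t: "\<And>x. continuous_on UNIV (t x)" "\<And>y. continuous_on UNIV (\<lambda>x. t x y)"
    and g: "g \<in> L2_space (empirical N b)"
  shows "AE x in empirical N a. L2_adjoint (empirical N a) (empirical N b) (kernel_operator (empirical N a) t) g x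
      = L2_inner (empirical N b) (t x) g"
proof -
  let ?\<mu> = "empirical N a" and ?\<nu> = "empirical N b"
  let ?T = "kernel_operator ?\<mu> t"
  have meas: "f \<in> borel_measurable borel" if "f \<in> L2_space (empirical N z)"
    for f and z :: "nat \<Rightarrow> 'c::topological_space"
    using L2_spaceD(1)[OF that] by (simp add: empirical_def)
  have tm: "t x \<in> borel_measurable borel" "(\<lambda>x. t x y) \<in> borel_measurable borel" for x y
    by (intro borel_measurable_continuous_onI t)+
  have inner: "L2_inner ?\<nu> (t x) g = (\<Sum>j<N. t x (b j) * g (b j)) / N" if "g \<in> L2_space ?\<nu>" for x g
    unfolding L2_inner_def using meas[OF that] tm by (intro integral_empirical) simp
  have op: "?T f y = (\<Sum>i<N. f (a i) * t (a i) y) / N" if "f \<in> L2_space ?\<mu>" for f y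
    unfolding kernel_operator_def using meas[OF that] tm by (intro integral_empirical) simp
  have h: "(\<lambda>x. L2_inner ?\<nu> (t x) g) \<in> L2_space ?\<mu>" if g: "g \<in> L2_space ?\<nu>" for g
    unfolding inner[OF g] using tm by (intro L2_space_empirical) simp
  have adj: "L2_inner ?\<nu> (?T f) g = L2_inner ?\<mu> f (\<lambda>x. L2_inner ?\<nu> (t x) g)"
    if f: "f \<in> L2_space ?\<mu>" and g: "g \<in> L2_space ?\<nu>" for f g
  proof -
    have "L2_inner ?\<nu> (?T f) g = (\<Sum>j<N. (\<Sum>i<N. f (a i) * t (a i) (b j)) / N * g (b j)) / N"
      unfolding L2_inner_def op[OF f] using meas[OF g] tm by (intro integral_empirical) simp
    also have "\<dots> = (\<Sum>j<N. \<Sum>i<N. f (a i) * t (a i) (b j) * g (b j) / N) / N"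
      by (simp add: sum_divide_distrib sum_distrib_right)
    also have "\<dots> = (\<Sum>i<N. \<Sum>j<N. f (a i) * t (a i) (b j) * g (b j) / N) / N"
      by (subst sum.swap) (rule refl)
    also have "\<dots> = (\<Sum>i<N. f (a i) * ((\<Sum>j<N. t (a i) (b j) * g (b j)) / N)) / N"
      by (simp add: sum_divide_distrib sum_distrib_left mult.assoc)
    also have "\<dots> = L2_inner ?\<mu> f (\<lambda>x. L2_inner ?\<nu> (t x) g)"
      unfolding L2_inner_def[of ?\<mu>] inner[OF g] using meas[OF f] tm by (intro integral_empirical[symmetric]) simp
    finally show ?thesis .
  qed
  have ex: "\<exists>h\<in>L2_space ?\<mu>. \<forall>f\<in>L2_space ?\<mu>. L2_inner ?\<nu> (?T f) g = L2_inner ?\<mu> f h"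
    if "g \<in> L2_space ?\<nu>" for g
    using h[OF that] adj[OF _ that] by blast
  show ?thesis
  proof (rule L2_adjoint_unique[OF L2_adjoint_characterization(1)[OF ex g] _ h[OF g]])
    show "L2_inner ?\<mu> f (L2_adjoint ?\<mu> ?\<nu> ?T g) = L2_inner ?\<mu> f (\<lambda>x. L2_inner ?\<nu> (t x) g)"
      if "f \<in> L2_space ?\<mu>" for f
      using L2_adjoint_characterization(2)[OF ex g that] adj[OF that g] by simp
  qed
qed

text \<open>
  The projection \<open>g\<close> is one of the two coordinates of the sample pairs, so that the same event
  statement serves both marginals. Almost every point lies in the support, where the ball-mass
  condition is available.
\<close>

lemma sample_ball_mass:
  fixes \<nu> :: "'a::{metric_space,second_countable_topology} measure"
    and g :: "'b::topological_space \<Rightarrow> 'a"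
  assumes \<nu>: "borel_prob \<nu>" "ball_mass \<nu> C D \<delta>" and eps: "0 < \<epsilon>" "\<epsilon> \<le> \<delta>"
    and N: "N \<ge> 1" and Z: "iid_sample P N \<pi> Z"
    and g: "g \<in> borel_measurable borel" "distr \<pi> borel g = \<nu>"
  shows "\<exists>A\<in>sets P. 1 - sample_defect N \<epsilon> C D \<le> measure P A \<and>
    (\<forall>\<omega>\<in>A. \<forall>i<N. C * \<epsilon> powr D / 2 \<le> measure (empirical N (g \<circ> (\<lambda>i. Z i \<omega>))) (ball (g (Z i \<omega>)) \<epsilon>))"
proof -
  interpret P: prob_space P using Z by (simp add: iid_sample_def)
  have Z': "P.indep_vars (\<lambda>_. borel) Z {..<N}" "\<And>i. i < N \<Longrightarrow> distr P borel (Z i) = \<pi>"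
    using Z by (auto simp: iid_sample_def)
  define p where "p = C * \<epsilon> powr D"
  have p: "0 \<le> p" using \<nu>(2) by (simp add: p_def ball_mass_def)
  have indep: "P.indep_vars (\<lambda>_. borel) (\<lambda>i \<omega>. g (Z i \<omega>)) {..<N}"
    by (rule P.indep_vars_compose2[OF Z'(1)]) (rule g)
  have law: "distr P borel (\<lambda>\<omega>. g (Z i \<omega>)) = \<nu>" if "i < N" for i
  proof -
    have "Z i \<in> borel_measurable P" using Z'(1) that by (auto simp: P.indep_vars_def)
    then show ?thesis using distr_distr[OF g(1), of "Z i" P] Z'(2)[OF that] g(2) by (simp add: comp_def)
  qed
  have mass: "AE y in \<nu>. p \<le> measure \<nu> (ball y \<epsilon>)"
    using AE_in_spt[of \<nu>] \<nu> eps by (auto simp: p_def ball_mass_def borel_prob_def elim!: eventually_mono)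
  obtain A where A: "A \<in> sets P" "1 - N * exp (- (N / 2) * p\<^sup>2) \<le> measure P A"
    "\<And>\<omega> i. \<omega> \<in> A \<Longrightarrow> i < N \<Longrightarrow> N * p / 2 \<le> (\<Sum>j<N. of_bool (dist (g (Z i \<omega>)) (g (Z j \<omega>)) < \<epsilon>))"
    using iid_ball_mass_event[OF P.prob_space_axioms indep law N \<nu>(1) eps(1) p mass] by blast
  have "p / 2 \<le> measure (empirical N (g \<circ> (\<lambda>i. Z i \<omega>))) (ball (g (Z i \<omega>)) \<epsilon>)" if "\<omega> \<in> A" "i < N" for \<omega> i
  proof -
    have "measure (empirical N (g \<circ> (\<lambda>i. Z i \<omega>))) (ball (g (Z i \<omega>)) \<epsilon>)
        = (\<integral>x. indicator (ball (g (Z i \<omega>)) \<epsilon>) x \<partial>empirical N (g \<circ> (\<lambda>i. Z i \<omega>)))"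
      by (simp add: empirical_def)
    also have "\<dots> = (\<Sum>j<N. indicator (ball (g (Z i \<omega>)) \<epsilon>) (g (Z j \<omega>))) / N"
      by (subst integral_empirical) (auto intro!: borel_measurable_indicator borel_open)
    also have "\<dots> = (\<Sum>j<N. of_bool (dist (g (Z i \<omega>)) (g (Z j \<omega>)) < \<epsilon>)) / N"
      by (intro arg_cong[where f="\<lambda>s. s / N"] sum.cong) (auto simp: indicator_def)
    finally have "measure (empirical N (g \<circ> (\<lambda>i. Z i \<omega>))) (ball (g (Z i \<omega>)) \<epsilon>)
        = (\<Sum>j<N. of_bool (dist (g (Z i \<omega>)) (g (Z j \<omega>)) < \<epsilon>)) / N" .
    moreover have "p / 2 \<le> (\<Sum>j<N. of_bool (dist (g (Z i \<omega>)) (g (Z j \<omega>)) < \<epsilon>)) / N"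
      using A(3)[OF that] N by (simp add: field_simps del: sum_of_bool_eq)
    ultimately show ?thesis by (simp only:)
  qed
  then show ?thesis
    using A(1,2) unfolding sample_defect_def p_def by blast
qed

theorem corollary2p36:
  fixes c :: "'a::{metric_space, second_countable_topology} \<Rightarrow> 'a \<Rightarrow> real"
    and \<mu> \<nu> :: "'a measure"
    and \<pi> :: "('a \<times> 'a) measure"
    and C\<^sub>\<mu> D\<^sub>\<mu> \<delta>\<^sub>\<mu> C\<^sub>\<nu> D\<^sub>\<nu> \<delta>\<^sub>\<nu> :: real
  assumes "compact (UNIV :: 'a set)"
    and "lipschitz_cost c"
    and "borel_prob \<mu>" and "borel_prob \<nu>"
    and "ball_mass \<mu> C\<^sub>\<mu> D\<^sub>\<mu> \<delta>\<^sub>\<mu>" and "ball_mass \<nu> C\<^sub>\<nu> D\<^sub>\<nu> \<delta>\<^sub>\<nu>"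
    and "\<pi> \<in> couplings \<mu> \<nu>"
  shows "\<exists>\<epsilon>\<^sub>0>0. \<exists>M>0. \<forall>N::nat. \<forall>\<epsilon>. \<forall>(P::'w measure) Z.
    N \<ge> 1 \<longrightarrow> 0 < \<epsilon> \<longrightarrow> \<epsilon> \<le> \<epsilon>\<^sub>0 \<longrightarrow> iid_sample P N \<pi> Z \<longrightarrow>
    with_prob_at_least P (1 - sample_defect N \<epsilon> C\<^sub>\<nu> D\<^sub>\<nu>) (\<lambda>\<omega>.
      let \<pi>\<^sub>N = empirical N (\<lambda>i. Z i \<omega>);
          \<mu>\<^sub>N = distr \<pi>\<^sub>N borel fst;
          \<nu>\<^sub>N = distr \<pi>\<^sub>N borel snd;
          t = transfer_kernel c \<epsilon> \<pi>\<^sub>N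
      in \<forall>s u v \<gamma>.
        singular_pair \<mu>\<^sub>N \<nu>\<^sub>N (kernel_operator \<mu>\<^sub>N t) s u v \<longrightarrow>
        optimal_plan \<nu> \<nu>\<^sub>N \<gamma> \<longrightarrow>
        L2_norm \<nu> (\<lambda>y. (1 / s) * L2_inner \<mu>\<^sub>N (\<lambda>x. t x y) u
                       - L2_adjoint \<nu> \<nu>\<^sub>N (plan_operator \<nu> \<nu>\<^sub>N \<gamma>) v y)
          \<le> M * (1 / s) * L2_norm \<mu>\<^sub>N u * (W2 \<nu>\<^sub>N \<nu> / \<epsilon> powr (1 + D\<^sub>\<nu>))) \<and>
    with_prob_at_least P (1 - sample_defect N \<epsilon> C\<^sub>\<mu> D\<^sub>\<mu>) (\<lambda>\<omega>.
      let \<pi>\<^sub>N = empirical N (\<lambda>i. Z i \<omega>);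
          \<mu>\<^sub>N = distr \<pi>\<^sub>N borel fst;
          \<nu>\<^sub>N = distr \<pi>\<^sub>N borel snd;
          t = transfer_kernel c \<epsilon> \<pi>\<^sub>N
      in \<forall>s u v \<gamma>.
        singular_pair \<mu>\<^sub>N \<nu>\<^sub>N (kernel_operator \<mu>\<^sub>N t) s u v \<longrightarrow>
        optimal_plan \<mu> \<mu>\<^sub>N \<gamma> \<longrightarrow>
        L2_norm \<mu> (\<lambda>x. (1 / s) * L2_inner \<nu>\<^sub>N (\<lambda>y. t x y) v
                       - L2_adjoint \<mu> \<mu>\<^sub>N (plan_operator \<mu> \<mu>\<^sub>N \<gamma>) u x)
          \<le> M * (1 / s) * L2_norm \<nu>\<^sub>N v * (W2 \<mu>\<^sub>N \<mu> / \<epsilon> powr (1 + D\<^sub>\<mu>)))"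
proof -
  note X = assms(1)
  from assms(2) obtain L where L: "L > 0" "\<And>x x' y. \<bar>c x y - c x' y\<bar> \<le> L * dist x x'"
    and c: "continuous_on UNIV (\<lambda>(x, y). c x y)" "\<And>x y. c x y = c y x" "\<And>x. c x x = 0"
    unfolding lipschitz_cost_def by metis
  have L0: "L \<ge> 0" using L(1) by simp
  have C: "0 < C\<^sub>\<mu>" "0 < C\<^sub>\<nu>" "0 < \<delta>\<^sub>\<mu>" "0 < \<delta>\<^sub>\<nu>" using assms(5,6) by (auto simp: ball_mass_def)
  define M where "M = 4 * L * exp (2 * L) / min C\<^sub>\<mu> C\<^sub>\<nu>"
  have const_le: "exp (2 * L) / (C * \<epsilon> powr D / 2) * (2 * L / \<epsilon>) * (1 / s) * n * W
      \<le> M * (1 / s) * n * (W / \<epsilon> powr (1 + D))"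
    if "min C\<^sub>\<mu> C\<^sub>\<nu> \<le> C" "0 < \<epsilon>" "0 < s" "0 \<le> n" "0 \<le> W" for C D \<epsilon> s n W :: real
  proof -
    have "exp (2 * L) / (C * \<epsilon> powr D / 2) * (2 * L / \<epsilon>) * (1 / s) * n * W
        = 4 * L * exp (2 * L) / C * ((1 / s) * n * (W / \<epsilon> powr (1 + D)))"
      using that C by (simp add: powr_add field_simps)
    also have "\<dots> \<le> M * ((1 / s) * n * (W / \<epsilon> powr (1 + D)))"
      unfolding M_def using that C L by (intro mult_right_mono divide_left_mono) auto
    finally show ?thesis by (simp add: mult.assoc)
  qed
  have proj: "fst \<in> borel_measurable (borel :: ('a \<times> 'a) measure)" "snd \<in> borel_measurable (borel :: ('a \<times> 'a) measure)"
    by (auto intro!: borel_measurable_continuous_onI continuous_intros)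
  have marg: "distr \<pi> borel fst = \<mu>" "distr \<pi> borel snd = \<nu>" using assms(7) by (auto simp: couplings_def)
  have W0: "0 \<le> W2 \<sigma>' \<sigma>" if "optimal_plan \<sigma> \<sigma>' \<gamma>" for \<sigma> \<sigma>' :: "'a measure" and \<gamma>
    using optimal_plan_le_W2[OF that] by (rule order_trans[rotated]) (simp add: sq_cost_def)
  show ?thesis
  proof (rule exI[of _ "min \<delta>\<^sub>\<mu> \<delta>\<^sub>\<nu>"], intro exI[of _ M] conjI allI impI)
    show "0 < min \<delta>\<^sub>\<mu> \<delta>\<^sub>\<nu>" "0 < M" using C L by (auto simp: M_def)
  next
    fix N :: nat and \<epsilon> :: real and P :: "'w measure" and Z
    assume N: "1 \<le> N" and eps: "0 < \<epsilon>" "\<epsilon> \<le> min \<delta>\<^sub>\<mu> \<delta>\<^sub>\<nu>" and Z: "iid_sample P N \<pi> Z"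
    define z where "z \<omega> i = Z i \<omega>" for \<omega> i
    define t where "t \<omega> = transfer_kernel c \<epsilon> (empirical N (z \<omega>))" for \<omega>
    have marginals: "distr (empirical N (z \<omega>)) borel fst = empirical N (fst \<circ> z \<omega>)"
      "distr (empirical N (z \<omega>)) borel snd = empirical N (snd \<circ> z \<omega>)" for \<omega>
      by (intro distr_empirical proj)+
    have emp: "borel_prob (empirical N a)" for a :: "nat \<Rightarrow> 'a" using N by (rule borel_prob_empirical)
    have m: "0 < C\<^sub>\<mu> * \<epsilon> powr D\<^sub>\<mu> / 2" "0 < C\<^sub>\<nu> * \<epsilon> powr D\<^sub>\<nu> / 2" using C eps by auto
    note lip = transfer_kernel_lipschitz[OF X N c L(2) L0 eps(1), of _ "z \<omega>" for \<omega>, folded t_def]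
    have tc: "continuous_on UNIV (\<lambda>x. t \<omega> x y)" "continuous_on UNIV (t \<omega> x)" for \<omega> x y
      by (rule lip(3)[OF zero_less_one], rule lip(4)[OF zero_less_one])
    obtain A where A: "A \<in> sets P" "1 - sample_defect N \<epsilon> C\<^sub>\<nu> D\<^sub>\<nu> \<le> measure P A"
      "\<And>\<omega> i. \<omega> \<in> A \<Longrightarrow> i < N \<Longrightarrow>
        C\<^sub>\<nu> * \<epsilon> powr D\<^sub>\<nu> / 2 \<le> measure (empirical N (snd \<circ> z \<omega>)) (ball (snd (z \<omega> i)) \<epsilon>)"
    proof -
      have "\<epsilon> \<le> \<delta>\<^sub>\<nu>" using eps(2) by simp
      from sample_ball_mass[OF assms(4,6) eps(1) this N Z proj(2) marg(2), folded z_def] that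
      show thesis unfolding z_def by blast
    qed
    show "with_prob_at_least P (1 - sample_defect N \<epsilon> C\<^sub>\<nu> D\<^sub>\<nu>) (\<lambda>\<omega>.
      let \<pi>\<^sub>N = empirical N (\<lambda>i. Z i \<omega>);
          \<mu>\<^sub>N = distr \<pi>\<^sub>N borel fst;
          \<nu>\<^sub>N = distr \<pi>\<^sub>N borel snd;
          t = transfer_kernel c \<epsilon> \<pi>\<^sub>N
      in \<forall>s u v \<gamma>.
        singular_pair \<mu>\<^sub>N \<nu>\<^sub>N (kernel_operator \<mu>\<^sub>N t) s u v \<longrightarrow>
        optimal_plan \<nu> \<nu>\<^sub>N \<gamma> \<longrightarrow>
        L2_norm \<nu> (\<lambda>y. (1 / s) * L2_inner \<mu>\<^sub>N (\<lambda>x. t x y) u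
                       - L2_adjoint \<nu> \<nu>\<^sub>N (plan_operator \<nu> \<nu>\<^sub>N \<gamma>) v y)
          \<le> M * (1 / s) * L2_norm \<mu>\<^sub>N u * (W2 \<nu>\<^sub>N \<nu> / \<epsilon> powr (1 + D\<^sub>\<nu>)))"
      unfolding with_prob_at_least_def Let_def z_def[symmetric] marginals t_def[symmetric]
    proof (intro bexI[OF _ A(1)] conjI A(2) ballI allI impI)
      fix \<omega> s u v \<gamma>
      let ?\<mu> = "empirical N (fst \<circ> z \<omega>)" and ?\<nu> = "empirical N (snd \<circ> z \<omega>)"
      assume \<omega>: "\<omega> \<in> A" and sp: "singular_pair ?\<mu> ?\<nu> (kernel_operator ?\<mu> (t \<omega>)) s u v"
        and opt: "optimal_plan \<nu> ?\<nu> \<gamma>"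
      have s: "0 < s" and uv: "u \<in> L2_space ?\<mu>" "v \<in> L2_space ?\<nu>"
        and ae: "AE y in ?\<nu>. v y = (1 / s) * L2_inner ?\<mu> (\<lambda>x. t \<omega> x y) u"
        using sp by (auto simp: singular_pair_def kernel_operator_def L2_inner_def mult.commute)
      have "L2_norm \<nu> (\<lambda>y. (1 / s) * L2_inner ?\<mu> (\<lambda>x. t \<omega> x y) u
            - L2_adjoint \<nu> ?\<nu> (plan_operator \<nu> ?\<nu> \<gamma>) v y)
          \<le> exp (2 * L) / (C\<^sub>\<nu> * \<epsilon> powr D\<^sub>\<nu> / 2) * (2 * L / \<epsilon>) * (1 / s) * L2_norm ?\<mu> u * W2 ?\<nu> \<nu>"
      proof (rule singular_extension_distance[OF X emp assms(4) opt tc(1) _ _ s uv ae])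
        show "\<bar>t \<omega> x y - t \<omega> x y'\<bar> \<le> exp (2 * L) / (C\<^sub>\<nu> * \<epsilon> powr D\<^sub>\<nu> / 2) * (2 * L / \<epsilon>) * dist y y'" for x y y'
          by (rule lip(1)[OF m(2) A(3)[OF \<omega>]])
        show "0 \<le> exp (2 * L) / (C\<^sub>\<nu> * \<epsilon> powr D\<^sub>\<nu> / 2) * (2 * L / \<epsilon>)" using C L0 eps by simp
      qed
      also have "\<dots> \<le> M * (1 / s) * L2_norm ?\<mu> u * (W2 ?\<nu> \<nu> / \<epsilon> powr (1 + D\<^sub>\<nu>))"
        using W0[OF opt] eps s by (intro const_le) (auto simp: L2_norm_def)
      finally show "L2_norm \<nu> (\<lambda>y. (1 / s) * L2_inner ?\<mu> (\<lambda>x. t \<omega> x y) u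
            - L2_adjoint \<nu> ?\<nu> (plan_operator \<nu> ?\<nu> \<gamma>) v y)
          \<le> M * (1 / s) * L2_norm ?\<mu> u * (W2 ?\<nu> \<nu> / \<epsilon> powr (1 + D\<^sub>\<nu>))" .
    qed
    obtain B where B: "B \<in> sets P" "1 - sample_defect N \<epsilon> C\<^sub>\<mu> D\<^sub>\<mu> \<le> measure P B"
      "\<And>\<omega> i. \<omega> \<in> B \<Longrightarrow> i < N \<Longrightarrow>
        C\<^sub>\<mu> * \<epsilon> powr D\<^sub>\<mu> / 2 \<le> measure (empirical N (fst \<circ> z \<omega>)) (ball (fst (z \<omega> i)) \<epsilon>)"
    proof -
      have "\<epsilon> \<le> \<delta>\<^sub>\<mu>" using eps(2) by simp
      from sample_ball_mass[OF assms(3,5) eps(1) this N Z proj(1) marg(1), folded z_def] that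
      show thesis unfolding z_def by blast
    qed
    show "with_prob_at_least P (1 - sample_defect N \<epsilon> C\<^sub>\<mu> D\<^sub>\<mu>) (\<lambda>\<omega>.
      let \<pi>\<^sub>N = empirical N (\<lambda>i. Z i \<omega>);
          \<mu>\<^sub>N = distr \<pi>\<^sub>N borel fst;
          \<nu>\<^sub>N = distr \<pi>\<^sub>N borel snd;
          t = transfer_kernel c \<epsilon> \<pi>\<^sub>N
      in \<forall>s u v \<gamma>.
        singular_pair \<mu>\<^sub>N \<nu>\<^sub>N (kernel_operator \<mu>\<^sub>N t) s u v \<longrightarrow>
        optimal_plan \<mu> \<mu>\<^sub>N \<gamma> \<longrightarrow>
        L2_norm \<mu> (\<lambda>x. (1 / s) * L2_inner \<nu>\<^sub>N (\<lambda>y. t x y) v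
                       - L2_adjoint \<mu> \<mu>\<^sub>N (plan_operator \<mu> \<mu>\<^sub>N \<gamma>) u x)
          \<le> M * (1 / s) * L2_norm \<nu>\<^sub>N v * (W2 \<mu>\<^sub>N \<mu> / \<epsilon> powr (1 + D\<^sub>\<mu>)))"
      unfolding with_prob_at_least_def Let_def z_def[symmetric] marginals t_def[symmetric]
    proof (intro bexI[OF _ B(1)] conjI B(2) ballI allI impI)
      fix \<omega> s u v \<gamma>
      let ?\<mu> = "empirical N (fst \<circ> z \<omega>)" and ?\<nu> = "empirical N (snd \<circ> z \<omega>)"
      assume \<omega>: "\<omega> \<in> B" and sp: "singular_pair ?\<mu> ?\<nu> (kernel_operator ?\<mu> (t \<omega>)) s u v"
        and opt: "optimal_plan \<mu> ?\<mu> \<gamma>"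
      have s: "0 < s" and uv: "v \<in> L2_space ?\<nu>" "u \<in> L2_space ?\<mu>"
        and "AE x in ?\<mu>. u x = (1 / s) * L2_adjoint ?\<mu> ?\<nu> (kernel_operator ?\<mu> (t \<omega>)) v x"
        using sp by (auto simp: singular_pair_def)
      from this(4) kernel_operator_adjoint_empirical[OF tc(2,1)[where \<omega>=\<omega>] uv(1), where a="fst \<circ> z \<omega>"]
      have ae: "AE x in ?\<mu>. u x = (1 / s) * L2_inner ?\<nu> (\<lambda>y. t \<omega> x y) v"
        by eventually_elim simp
      have "L2_norm \<mu> (\<lambda>x. (1 / s) * L2_inner ?\<nu> (\<lambda>y. t \<omega> x y) v
            - L2_adjoint \<mu> ?\<mu> (plan_operator \<mu> ?\<mu> \<gamma>) u x)
          \<le> exp (2 * L) / (C\<^sub>\<mu> * \<epsilon> powr D\<^sub>\<mu> / 2) * (2 * L / \<epsilon>) * (1 / s) * L2_norm ?\<nu> v * W2 ?\<mu> \<mu>"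
      proof (rule singular_extension_distance[where \<tau>="\<lambda>y x. t \<omega> x y", OF X emp assms(3) opt tc(2) _ _ s uv ae])
        show "\<bar>t \<omega> x y - t \<omega> x' y\<bar> \<le> exp (2 * L) / (C\<^sub>\<mu> * \<epsilon> powr D\<^sub>\<mu> / 2) * (2 * L / \<epsilon>) * dist x x'" for x x' y
          by (rule lip(2)[OF m(1) B(3)[OF \<omega>]])
        show "0 \<le> exp (2 * L) / (C\<^sub>\<mu> * \<epsilon> powr D\<^sub>\<mu> / 2) * (2 * L / \<epsilon>)" using C L0 eps by simp
      qed
      also have "\<dots> \<le> M * (1 / s) * L2_norm ?\<nu> v * (W2 ?\<mu> \<mu> / \<epsilon> powr (1 + D\<^sub>\<mu>))"
        using W0[OF opt] eps s by (intro const_le) (auto simp: L2_norm_def)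
      finally show "L2_norm \<mu> (\<lambda>x. (1 / s) * L2_inner ?\<nu> (\<lambda>y. t \<omega> x y) v
            - L2_adjoint \<mu> ?\<mu> (plan_operator \<mu> ?\<mu> \<gamma>) u x)
          \<le> M * (1 / s) * L2_norm ?\<nu> v * (W2 ?\<mu> \<mu> / \<epsilon> powr (1 + D\<^sub>\<mu>))" .
    qed
  qed
qed

end
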